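(* Let $p\colon E\to X$ be a Lipschitz submersion of metric spaces, where $X$ is locally compact and locally connected. Let $y\in E$, $b=p(y)$, $F=p^{-1}(b)$, and assume that $F$ is locally connected and locally compact and that $\mathcal{L}^{*}(F)$ holds. If $C$ is a compact subset of $F$, then there exist a neighborhood $U$ of $C$ in $F$, a neighborhood $N$ of $b$ in $X$, and a Lipschitz product chart $f\colon U\times N\to E$ about $U$ for $p$. Hence, if $p$ is proper and for each $x\in X$ the fiber $p^{-1}(x)$ is locally connected and $\mathcal{L}^{*}(p^{-1}(x))$ holds, then $p$ is a Lipschitz bundle map.
   Context: Lipschitz is a local condition: a map $f\colon X\to Y$ of metric spaces is Lipschitz if every $x\in X$ has an open neighborhood on which $f$ satisfies $d_Y(f(x'),f(x''))\le L_x d_X(x',x'')$ for some constant $L_x$. It is a Lipschitz embedding if it is injective and both $f\colon X\to f(X)$ and $f^{-1}\colon f(X)\to X$ are Lipschitz; a Lipschitz isomorphism is a bijective Lipschitz embedding. An open Lipschitz embedding is a Lipschitz embedding that is an open map. Products carry the sum metric; subsets carry the restricted metric. Lipschitz submersion and product chart: a Lipschitz map $p\colon E\to X$ is a Lipschitz submersion if for each $y\in E$ there exist an open neighborhood $U$ of $y$ in $F=p^{-1}(p(y))$, a neighborhood $N$ of $p(y)$ in $X$, and an open Lipschitz embedding $f\colon U\times N\to E$ onto a neighborhood of $y$ such that $p\circ f\colon U\times N\to N$ is the projection and $f(u,p(y))=u$ for all $u\in U$. In general, for $U$ open in a fiber $F=p^{-1}(b)$ and $N$ a neighborhood of $b$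 in $X$, a Lipschitz product chart about $U$ for $p$ is an open Lipschitz embedding $f\colon U\times N\to E$ with $p\circ f$ the projection to $N$ and $f(u,b)=u$ for all $u\in U$. Lipschitz bundle map: every $x\in X$ has a neighborhood $N'$ and a Lipschitz isomorphism $h\colon p^{-1}(x)\times N'\to p^{-1}(N')$ with $p\circ h$ the projection to $N'$. Lipschitz isotopy: for metric spaces $B,U,Y$, a family $h_t\colon U\to Y$ ($t\in B$) gives a Lipschitz isotopy if the map $B\times U\to B\times Y$, $(t,x)\mapsto(t,h_t(x))$, is an open embedding that is a Lipschitz isomorphism onto its image. $\mathcal{L}^{*}(Y)$, for a metric space $Y$: for every open $U\subseteq Y$ and compact $D\subseteq U$ the following holds. For every open Lipschitz embedding $h\colon U\to Y$ sufficiently near the inclusion $i\colon U\to Y$ (in the compact-open topology) there is a Lipschitz isomorphism $h'\colon Y\to Y$ with $h'=h$ on $D$ and $h'$ equal to the identity on $Y-U$; the rule $h\mapsto h'$ is continuous in $h$ for $h$ sufficiently near $i$ and sends $i$ to $\mathrm{id}_Y$; and moreover (P): for every metric space $B$, if $h_t\colon U\to Y$ ($t\in B$) gives a Lipschitz isotopy such that the rule $h_t\mapsto h_t'$ is well defined for all $t\in B$, then $h'_t\colon Y\to Y$ ($t\in B$) gives a Lipschitz isotopy. *)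

theory Defs
  imports "HOL-Analysis.Analysis"
begin

definition sum_metric :: "'a metric \<Rightarrow> 'b metric \<Rightarrow> ('a \<times> 'b) metric" where
  "sum_metric M N =
     metric (mspace M \<times> mspace N, \<lambda>(x, y) (x', y'). mdist M x x' + mdist N y y')"

lemma Metric_space_sum_metric:
  "Metric_space (mspace M \<times> mspace N) (\<lambda>(x, y) (x', y'). mdist M x x' + mdist N y y')"
proof
  fix u v
  show "0 \<le> (case u of (x, y) \<Rightarrow> \<lambda>(x', y'). mdist M x x' + mdist N y y') v"
    by (auto split: prod.splits)
  show "(case u of (x, y) \<Rightarrow> \<lambda>(x', y'). mdist M x x' + mdist N y y') v =
        (case v of (x, y) \<Rightarrow> \<lambda>(x', y'). mdist M x x' + mdist N y y') u"
    by (auto split: prod.splits simp: mdist_commute)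
next
  fix u v
  assume "u \<in> mspace M \<times> mspace N" "v \<in> mspace M \<times> mspace N"
  then show "((case u of (x, y) \<Rightarrow> \<lambda>(x', y'). mdist M x x' + mdist N y y') v = 0) = (u = v)"
    by (auto split: prod.splits simp: add_nonneg_eq_0_iff)
next
  fix u v w
  assume "u \<in> mspace M \<times> mspace N" "v \<in> mspace M \<times> mspace N" "w \<in> mspace M \<times> mspace N"
  then show "(case u of (x, y) \<Rightarrow> \<lambda>(x', y'). mdist M x x' + mdist N y y') w \<le>
        (case u of (x, y) \<Rightarrow> \<lambda>(x', y'). mdist M x x' + mdist N y y') v +
        (case v of (x, y) \<Rightarrow> \<lambda>(x', y'). mdist M x x' + mdist N y y') w"
    by (auto split: prod.splits) (smt (verit) mdist_triangle)
qed

lemma mspace_sum_metric [simp]: "mspace (sum_metric M N) = mspace M \<times> mspace N"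
  unfolding sum_metric_def
  by (simp add: Metric_space.mspace_metric [OF Metric_space_sum_metric])

lemma mdist_sum_metric [simp]:
  "mdist (sum_metric M N) (x, y) (x', y') = mdist M x x' + mdist N y y'"
  unfolding sum_metric_def
  by (simp add: Metric_space.mdist_metric [OF Metric_space_sum_metric])

text \<open>Lipschitz is understood locally throughout; \<^const>\<open>Lipschitz_continuous_map\<close>
  is the library's notion with one global constant.\<close>

definition lipschitz_map :: "'a metric \<Rightarrow> 'b metric \<Rightarrow> ('a \<Rightarrow> 'b) \<Rightarrow> bool" where
  "lipschitz_map X Y f \<longleftrightarrow>
     (\<forall>x\<in>mspace X. \<exists>V. openin (mtopology_of X) V \<and> x \<in> V \<and>
        Lipschitz_continuous_map (submetric X V) Y f)"

definition lipschitz_embedding :: "'a metric \<Rightarrow> 'b metric \<Rightarrow> ('a \<Rightarrow> 'b) \<Rightarrow> bool" where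
  "lipschitz_embedding X Y f \<longleftrightarrow>
     f \<in> mspace X \<rightarrow> mspace Y \<and> inj_on f (mspace X) \<and>
     lipschitz_map X (submetric Y (f ` mspace X)) f \<and>
     lipschitz_map (submetric Y (f ` mspace X)) X (inv_into (mspace X) f)"

definition lipschitz_isomorphism :: "'a metric \<Rightarrow> 'b metric \<Rightarrow> ('a \<Rightarrow> 'b) \<Rightarrow> bool" where
  "lipschitz_isomorphism X Y f \<longleftrightarrow>
     lipschitz_embedding X Y f \<and> bij_betw f (mspace X) (mspace Y)"

definition open_lipschitz_embedding :: "'a metric \<Rightarrow> 'b metric \<Rightarrow> ('a \<Rightarrow> 'b) \<Rightarrow> bool" where
  "open_lipschitz_embedding X Y f \<longleftrightarrow>
     lipschitz_embedding X Y f \<and> open_map (mtopology_of X) (mtopology_of Y) f"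

definition fiber :: "'e metric \<Rightarrow> ('e \<Rightarrow> 'x) \<Rightarrow> 'x \<Rightarrow> 'e metric" where
  "fiber E p b = submetric E {e \<in> mspace E. p e = b}"

text \<open>Neighborhoods of a point are not required to be open.\<close>

definition lipschitz_product_chart ::
  "'e metric \<Rightarrow> 'x metric \<Rightarrow> ('e \<Rightarrow> 'x) \<Rightarrow> 'x \<Rightarrow> 'e set \<Rightarrow> 'x set \<Rightarrow> ('e \<times> 'x \<Rightarrow> 'e) \<Rightarrow> bool"
where
  "lipschitz_product_chart E X p b U N f \<longleftrightarrow>
     openin (mtopology_of (fiber E p b)) U \<and>
     N \<subseteq> mspace X \<and> b \<in> mtopology_of X interior_of N \<and>
     open_lipschitz_embedding (sum_metric (submetric E U) (submetric X N)) E f \<and>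
     (\<forall>u\<in>U. \<forall>x\<in>N. p (f (u, x)) = x) \<and>
     (\<forall>u\<in>U. f (u, b) = u)"

definition lipschitz_submersion :: "'e metric \<Rightarrow> 'x metric \<Rightarrow> ('e \<Rightarrow> 'x) \<Rightarrow> bool" where
  "lipschitz_submersion E X p \<longleftrightarrow>
     lipschitz_map E X p \<and>
     (\<forall>y\<in>mspace E. \<exists>U N f. y \<in> U \<and> lipschitz_product_chart E X p (p y) U N f \<and>
        y \<in> mtopology_of E interior_of (f ` (U \<times> N)))"

definition lipschitz_bundle_map :: "'e metric \<Rightarrow> 'x metric \<Rightarrow> ('e \<Rightarrow> 'x) \<Rightarrow> bool" where
  "lipschitz_bundle_map E X p \<longleftrightarrow>
     p \<in> mspace E \<rightarrow> mspace X \<and>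
     (\<forall>x\<in>mspace X. \<exists>N h. N \<subseteq> mspace X \<and> x \<in> mtopology_of X interior_of N \<and>
        lipschitz_isomorphism (sum_metric (fiber E p x) (submetric X N))
          (submetric E {e \<in> mspace E. p e \<in> N}) h \<and>
        (\<forall>e\<in>mspace (fiber E p x). \<forall>n\<in>N. p (h (e, n)) = n))"

definition lipschitz_isotopy ::
  "'b metric \<Rightarrow> 'a metric \<Rightarrow> 'c metric \<Rightarrow> ('b \<Rightarrow> 'a \<Rightarrow> 'c) \<Rightarrow> bool" where
  "lipschitz_isotopy B U Y h \<longleftrightarrow>
     open_lipschitz_embedding (sum_metric B U) (sum_metric B Y) (\<lambda>(t, x). (t, h t x))"

text \<open>The points of the function space are the continuous maps, made extensional so that
  two maps agreeing on \<^term>\<open>topspace X\<close> are equal.\<close>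

definition compact_open_topology ::
  "'a topology \<Rightarrow> 'b topology \<Rightarrow> ('a \<Rightarrow> 'b) topology" where
  "compact_open_topology X Y =
     topology_generated_by
       {{f \<in> extensional (topspace X). continuous_map X Y f \<and> f ` K \<subseteq> V} | K V.
          compactin X K \<and> openin Y V}"

lemma topspace_compact_open_topology [simp]:
  "topspace (compact_open_topology X Y) = {f \<in> extensional (topspace X). continuous_map X Y f}"
proof -
  have "\<exists>S. (\<exists>K V. S = {f \<in> extensional (topspace X). continuous_map X Y f \<and> f ` K \<subseteq> V} \<and>
            compactin X K \<and> openin Y V) \<and> g \<in> S"
    if "g \<in> extensional (topspace X)" "continuous_map X Y g" for g
    using that
    by (intro exI [where x = "{f \<in> extensional (topspace X). continuous_map X Y f \<and> f ` {} \<subseteq> {}}"]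
          conjI exI [where x = "{}"]) auto
  then show ?thesis
    unfolding compact_open_topology_def by auto
qed

definition open_lipschitz_embedding_space ::
  "'a metric \<Rightarrow> 'b metric \<Rightarrow> ('a \<Rightarrow> 'b) topology" where
  "open_lipschitz_embedding_space U Y =
     subtopology (compact_open_topology (mtopology_of U) (mtopology_of Y))
       {h. open_lipschitz_embedding U Y h}"

text \<open>The property $\mathcal{L}^*(Y)$.  The rule $h \mapsto h'$ is \<open>R\<close>, and \<open>\<N>\<close> is a
  neighborhood of the inclusion on which it is defined, continuous and satisfies (P).
  Shrinking the neighborhood preserves every clause, so \<open>\<N>\<close> may be taken open.

  A formula cannot quantify over types, so the parameter spaces \<open>B\<close> in (P) are all
  metric spaces carried by subsets of the type given as first argument.  For every infinite
  type this is the same as ranging over all metric spaces: being an open Lipschitz embedding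
  is tested on convergent sequences of parameters, so a failure of (P) over some \<open>B\<close> already
  occurs over a countable subspace of \<open>B\<close>, and (P) is invariant under isometries of \<open>B\<close>.
  For any type, finite or not, it is implied by the unrestricted property.\<close>

definition Lstar :: "'b itself \<Rightarrow> 'a metric \<Rightarrow> bool" where
  "Lstar (T :: 'b itself) Y \<longleftrightarrow>
     (\<forall>U D. openin (mtopology_of Y) U \<and> compactin (mtopology_of Y) D \<and> D \<subseteq> U \<longrightarrow>
       (\<exists>\<N> R.
          openin (open_lipschitz_embedding_space (submetric Y U) Y) \<N> \<and>
          restrict (\<lambda>x. x) U \<in> \<N> \<and>
          (\<forall>h\<in>\<N>. lipschitz_isomorphism Y Y (R h) \<and>
             (\<forall>x\<in>D. R h x = h x) \<and> (\<forall>x\<in>mspace Y - U. R h x = x)) \<and>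
          continuous_map
            (subtopology (open_lipschitz_embedding_space (submetric Y U) Y) \<N>)
            (compact_open_topology (mtopology_of Y) (mtopology_of Y)) R \<and>
          R (restrict (\<lambda>x. x) U) = restrict (\<lambda>x. x) (mspace Y) \<and>
          (\<forall>(B :: 'b metric) h.
             (\<forall>t\<in>mspace B. h t \<in> \<N>) \<and> lipschitz_isotopy B (submetric Y U) Y h \<longrightarrow>
             lipschitz_isotopy B Y Y (\<lambda>t. R (h t)))))"

end

theory Submission
  imports Defs
begin

text \<open>
  A Lipschitz product chart is glued from local ones.  Everything except injectivity is a local
  condition, so one works with germs of charts along a compact subset of the fiber $F$ over $b$:
  a map that is a germ of a product chart at $(u,b)$ for every $u$ in a compact set restricts to
  a chart on a neighborhood of this set, because it is the identity on the fiber over $b$ and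
  locally injective.

  Given germs $f$ along $A$ and $g$ along $B$, the transition maps $\varphi_t = g_t^{-1} f_t$ are
  defined near $A \cap B$ and tend to the inclusion as $t \to b$.  By $\mathcal{L}^*(F)$ they
  agree near $A \cap B$ with isomorphisms $\Phi_t$ of $F$ forming a Lipschitz isotopy, $\Phi_b =
  \mathrm{id}$.  Then $f$ near $A$ and $g_t \circ \Phi_t$ near $B$ coincide near $A \cap B$ and
  define a germ along $A \cup B$.  Compactness reduces the first claim to this step.  If $p$ is
  proper, the chart about the whole fiber contains all fibers over points close to $b$.
\<close>

subsection \<open>Locally bi-Lipschitz open maps\<close>

text \<open>The obstacle is that two germs along overlapping compact sets need not agree anywhere
  off the fiber over b. The transition \<phi>_t measures the discrepancy, but it is defined only
  near A \<inter> B, whereas g can be corrected along all of B only by a map of the whole fiber.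
  Extending \<phi>_t without losing the bi-Lipschitz bounds is what \<open>Lstar\<close> supplies.
  Continuity of the rule h \<mapsto> h' would not be enough: for g_t \<circ> \<Phi>_t to be a germ,
  the joint map (t, x) \<mapsto> (t, \<Phi>_t x) has to be locally bi-Lipschitz and open, in t as
  well as in x. This is clause (P), applied with a neighborhood of b in X as parameter space, so
  \<open>Lstar\<close> is taken at the type of points of X. Continuity enters elsewhere, for the
  family \<phi>_t itself: it must be near the inclusion in the compact-open topology, and this costs
  a further shrinking of the parameter neighborhood. Since \<Phi>_t agrees with \<phi>_t only on a
  prescribed compact set, that set must contain an open set around A \<inter> B; pasting on A
  \<inter> B alone would give no germ there.\<close>

definition bilip_on :: "'a metric \<Rightarrow> 'b metric \<Rightarrow> ('a \<Rightarrow> 'b) \<Rightarrow> 'a set \<Rightarrow> real \<Rightarrow> bool" where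
  "bilip_on X Y f V L \<longleftrightarrow>
     openin (mtopology_of X) V \<and> 0 < L \<and>
     (\<forall>W\<subseteq>V. openin (mtopology_of X) W \<longrightarrow> openin (mtopology_of Y) (f ` W)) \<and>
     (\<forall>u\<in>V. \<forall>v\<in>V. mdist Y (f u) (f v) \<le> L * mdist X u v \<and>
        mdist X u v \<le> L * mdist Y (f u) (f v))"

text \<open>In contrast to \<open>lipschitz_embedding\<close>, neither an inverse function nor the
  image of the whole space occurs, so the condition can be restricted, composed and pasted point by
  point.\<close>

definition bilip_at :: "'a metric \<Rightarrow> 'b metric \<Rightarrow> ('a \<Rightarrow> 'b) \<Rightarrow> 'a \<Rightarrow> bool" where
  "bilip_at X Y f x \<longleftrightarrow> (\<exists>V L. x \<in> V \<and> bilip_on X Y f V L)"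

lemma bilip_atI: "x \<in> V \<Longrightarrow> bilip_on X Y f V L \<Longrightarrow> bilip_at X Y f x"
  unfolding bilip_at_def by blast

lemma bilip_atE:
  assumes "bilip_at X Y f x"
  obtains V L where "x \<in> V" "bilip_on X Y f V L"
  using assms unfolding bilip_at_def by blast

lemma openin_mtopology_of_subset: "openin (mtopology_of X) U \<Longrightarrow> U \<subseteq> mspace X"
  using openin_subset[of "mtopology_of X" U] by simp

lemma openin_mtopology_of:
  "openin (mtopology_of X) U \<longleftrightarrow>
     U \<subseteq> mspace X \<and> (\<forall>x\<in>U. \<exists>r>0. \<forall>y\<in>mspace X. mdist X x y < r \<longrightarrow> y \<in> U)"
proof (cases "U \<subseteq> mspace X")
  case True
  interpret M: Metric_space "mspace X" "mdist X" by (rule Metric_space_mspace_mdist)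
  have "M.mball x r \<subseteq> U \<longleftrightarrow> (\<forall>y\<in>mspace X. mdist X x y < r \<longrightarrow> y \<in> U)"
    if "x \<in> U" for x r
    using that True unfolding subset_iff M.in_mball by blast
  then show ?thesis
    using True by (simp add: mtopology_of_def M.openin_mtopology Ball_def)
next
  case False
  then show ?thesis using openin_mtopology_of_subset[of X U] by blast
qed

lemma openin_mtopology_ofE:
  assumes "openin (mtopology_of X) U" "x \<in> U"
  obtains r where "r > 0" "\<And>y. y \<in> mspace X \<Longrightarrow> mdist X x y < r \<Longrightarrow> y \<in> U"
  using assms unfolding openin_mtopology_of by metis

lemma Hausdorff_space_mtopology_of: "Hausdorff_space (mtopology_of X)"
  by (simp add: Metric_space.Hausdorff_space_mtopology Metric_space_mspace_mdist mtopology_of_def)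

lemma bilip_on_openin: "bilip_on X Y f V L \<Longrightarrow> openin (mtopology_of X) V"
  by (simp add: bilip_on_def)

lemma bilip_on_subset: "bilip_on X Y f V L \<Longrightarrow> V \<subseteq> mspace X"
  by (simp add: bilip_on_openin openin_mtopology_of_subset)

lemma bilip_on_image_openin: "bilip_on X Y f V L \<Longrightarrow> openin (mtopology_of Y) (f ` V)"
  by (simp add: bilip_on_def)

lemma bilip_on_open_image:
  "bilip_on X Y f V L \<Longrightarrow> openin (mtopology_of X) W \<Longrightarrow> W \<subseteq> V \<Longrightarrow> openin (mtopology_of Y) (f ` W)"
  by (simp add: bilip_on_def)

text \<open>Openness of the image already places it inside the target space, so the definition needs
  no separate clause for this.\<close>

lemma bilip_on_image: "bilip_on X Y f V L \<Longrightarrow> x \<in> V \<Longrightarrow> f x \<in> mspace Y"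
  using bilip_on_image_openin openin_mtopology_of_subset by blast

lemma bilip_on_mdist_le:
  assumes "bilip_on X Y f V L" "u \<in> V" "v \<in> V"
  shows "mdist Y (f u) (f v) \<le> L * mdist X u v" "mdist X u v \<le> L * mdist Y (f u) (f v)"
  using assms by (simp_all add: bilip_on_def)

lemma bilip_on_inj_on:
  assumes "bilip_on X Y f V L" shows "inj_on f V"
proof
  fix u v assume uv: "u \<in> V" "v \<in> V" "f u = f v"
  then have "u \<in> mspace X" "v \<in> mspace X" "f v \<in> mspace Y"
    using bilip_on_subset[OF assms] bilip_on_image[OF assms] by auto
  moreover have "mdist X u v \<le> L * mdist Y (f u) (f v)"
    using bilip_on_mdist_le(2)[OF assms uv(1,2)] .
  moreover have "mdist Y (f v) (f v) = 0"
    using \<open>f v \<in> mspace Y\<close> by simp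
  ultimately have "mdist X u v = 0"
    using uv(3) by (simp add: order_antisym)
  then show "u = v"
    using \<open>u \<in> mspace X\<close> \<open>v \<in> mspace X\<close> by simp
qed

lemma bilip_on_mono:
  "bilip_on X Y f V L \<Longrightarrow> openin (mtopology_of X) W \<Longrightarrow> W \<subseteq> V \<Longrightarrow> bilip_on X Y f W L"
  by (simp add: bilip_on_def subset_iff)

lemma bilip_on_Int:
  "bilip_on X Y f V L \<Longrightarrow> openin (mtopology_of X) S \<Longrightarrow> bilip_on X Y f (V \<inter> S) L"
  by (meson Int_lower1 bilip_on_mono bilip_on_openin openin_Int)

lemma bilip_on_cong:
  assumes "bilip_on X Y f V L" "\<And>x. x \<in> V \<Longrightarrow> f x = g x"
  shows "bilip_on X Y g V L"
proof -
  have "f ` W = g ` W" if "W \<subseteq> V" for W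
    using assms(2) that by (intro image_cong) auto
  then show ?thesis
    using assms by (simp add: bilip_on_def)
qed

lemma bilip_on_preimage:
  assumes f: "bilip_on X Y f V L" and T: "openin (mtopology_of Y) T"
  shows "openin (mtopology_of X) {v \<in> V. f v \<in> T}"
  unfolding openin_mtopology_of
proof (intro conjI ballI)
  show "{v \<in> V. f v \<in> T} \<subseteq> mspace X" using bilip_on_subset[OF f] by auto
next
  fix x assume x: "x \<in> {v \<in> V. f v \<in> T}"
  obtain r where r: "r > 0" "\<And>y. y \<in> mspace Y \<Longrightarrow> mdist Y (f x) y < r \<Longrightarrow> y \<in> T"
    using T x unfolding openin_mtopology_of by blast
  obtain s where s: "s > 0" "\<And>y. y \<in> mspace X \<Longrightarrow> mdist X x y < s \<Longrightarrow> y \<in> V"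
    using bilip_on_openin[OF f] x unfolding openin_mtopology_of by blast
  have L: "L > 0" using f by (simp add: bilip_on_def)
  have "y \<in> {v \<in> V. f v \<in> T}" if y: "y \<in> mspace X" "mdist X x y < min s (r / L)" for y
  proof -
    have "y \<in> V" using s y by auto
    then have "mdist Y (f x) (f y) \<le> L * mdist X x y"
      using bilip_on_mdist_le[OF f] x by simp
    also have "\<dots> < r" using y L by (simp add: field_simps)
    finally show ?thesis using r(2) bilip_on_image[OF f \<open>y \<in> V\<close>] \<open>y \<in> V\<close> by blast
  qed
  then show "\<exists>r>0. \<forall>y\<in>mspace X. mdist X x y < r \<longrightarrow> y \<in> {v \<in> V. f v \<in> T}"
    using r(1) s(1) L by (intro exI[of _ "min s (r / L)"]) auto
qed

lemma bilip_on_compose: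
  assumes f: "bilip_on X Y f V L" and g: "bilip_on Y Z g V' L'"
  shows "bilip_on X Z (g \<circ> f) {v \<in> V. f v \<in> V'} (L * L')"
  unfolding bilip_on_def
proof (intro conjI allI impI ballI)
  show "openin (mtopology_of X) {v \<in> V. f v \<in> V'}"
    by (rule bilip_on_preimage[OF f bilip_on_openin[OF g]])
  have L: "L > 0" "L' > 0" using f g by (auto simp: bilip_on_def)
  then show "0 < L * L'" by simp
  fix W assume W: "W \<subseteq> {v \<in> V. f v \<in> V'}" "openin (mtopology_of X) W"
  then have "openin (mtopology_of Y) (f ` W)"
    using bilip_on_open_image[OF f] by blast
  moreover have "f ` W \<subseteq> V'" using W by auto
  ultimately show "openin (mtopology_of Z) ((g \<circ> f) ` W)"
    using bilip_on_open_image[OF g, of "f ` W"] by (simp add: image_image)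
next
  fix u v assume uv: "u \<in> {v \<in> V. f v \<in> V'}" "v \<in> {v \<in> V. f v \<in> V'}"
  have L: "L > 0" "L' > 0" using f g by (auto simp: bilip_on_def)
  have 1: "mdist Y (f u) (f v) \<le> L * mdist X u v" "mdist X u v \<le> L * mdist Y (f u) (f v)"
    using bilip_on_mdist_le[OF f] uv by auto
  have 2: "mdist Z (g (f u)) (g (f v)) \<le> L' * mdist Y (f u) (f v)"
    "mdist Y (f u) (f v) \<le> L' * mdist Z (g (f u)) (g (f v))"
    using bilip_on_mdist_le[OF g] uv by auto
  have "mdist Z (g (f u)) (g (f v)) \<le> L' * (L * mdist X u v)"
    using 2(1) 1(1) L by (meson mult_left_mono order_trans less_imp_le)
  then show "mdist Z ((g \<circ> f) u) ((g \<circ> f) v) \<le> L * L' * mdist X u v"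
    by (simp add: algebra_simps)
  have "mdist X u v \<le> L * (L' * mdist Z (g (f u)) (g (f v)))"
    using 1(2) 2(2) L by (meson mult_left_mono order_trans less_imp_le)
  then show "mdist X u v \<le> L * L' * mdist Z ((g \<circ> f) u) ((g \<circ> f) v)"
    by (simp add: algebra_simps)
qed

text \<open>The definition is symmetric under inversion: the two inequalities change places, and
  continuity of \<open>f\<close> becomes openness of \<open>g\<close>.\<close>

lemma bilip_on_inverse:
  assumes f: "bilip_on X Y f V L" and g: "\<And>v. v \<in> V \<Longrightarrow> g (f v) = v"
  shows "bilip_on Y X g (f ` V) L"
  unfolding bilip_on_def
proof (intro conjI allI impI ballI)
  show "openin (mtopology_of Y) (f ` V)" by (rule bilip_on_image_openin[OF f])
  show "0 < L" using f by (simp add: bilip_on_def)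
  fix W assume W: "W \<subseteq> f ` V" "openin (mtopology_of Y) W"
  have "g ` W = {v \<in> V. f v \<in> W}" using W(1) g by force
  then show "openin (mtopology_of X) (g ` W)" using bilip_on_preimage[OF f W(2)] by simp
next
  fix u v assume "u \<in> f ` V" "v \<in> f ` V"
  then obtain u' v' where "u' \<in> V" "v' \<in> V" "u = f u'" "v = f v'" by blast
  then show "mdist X (g u) (g v) \<le> L * mdist Y u v" "mdist Y u v \<le> L * mdist X (g u) (g v)"
    using f g bilip_on_mdist_le[OF f] by auto
qed

lemma bilip_on_submetric_dom:
  assumes "openin (mtopology_of X) S" "V \<subseteq> S"
  shows "bilip_on (submetric X S) Y f V L \<longleftrightarrow> bilip_on X Y f V L"
proof -
  have "openin (mtopology_of (submetric X S)) W \<longleftrightarrow> openin (mtopology_of X) W"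
    if "W \<subseteq> V" for W
    using that assms by (auto simp: mtopology_of_submetric openin_open_subtopology)
  then show ?thesis unfolding bilip_on_def by auto
qed

text \<open>The two directions differ for the codomain: an open set of \<open>Y\<close> contained in
  \<open>S\<close> is open in \<open>S\<close> for any \<open>S\<close>, while the way back requires
  \<open>S\<close> to be open.\<close>

lemma bilip_on_submetric_cod:
  assumes f: "bilip_on X Y f V L" and S: "f ` V \<subseteq> S"
  shows "bilip_on X (submetric Y S) f V L"
proof -
  have "openin (mtopology_of (submetric Y S)) (f ` W)"
    if "W \<subseteq> V" "openin (mtopology_of Y) (f ` W)" for W
    using that S unfolding mtopology_of_submetric
    by (metis image_mono inf.absorb_iff1 openin_subtopology_Int subset_trans)
  then show ?thesis using f unfolding bilip_on_def by auto
qed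

lemma bilip_on_submetric_cod_open:
  assumes f: "bilip_on X (submetric Y S) f V L" and S: "openin (mtopology_of Y) S"
  shows "bilip_on X Y f V L"
  using assms unfolding bilip_on_def
  by (simp add: mtopology_of_submetric openin_open_subtopology)

lemma bilip_at_cong:
  assumes "bilip_at X Y f x" "openin (mtopology_of X) V" "x \<in> V" "\<And>v. v \<in> V \<Longrightarrow> f v = g v"
  shows "bilip_at X Y g x"
proof -
  obtain V' L where V': "x \<in> V'" "bilip_on X Y f V' L" using assms(1) by (auto elim: bilip_atE)
  then have "bilip_on X Y f (V' \<inter> V) L"
    by (simp add: bilip_on_Int[OF V'(2) assms(2)])
  then have "bilip_on X Y g (V' \<inter> V) L" using assms(4) by (rule bilip_on_cong) blast
  then show ?thesis using V' assms(3) by (intro bilip_atI[of x "V' \<inter> V"]) auto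
qed

lemma bilip_at_compose:
  assumes "bilip_at X Y f x" "bilip_at Y Z g (f x)"
  shows "bilip_at X Z (\<lambda>v. g (f v)) x"
proof -
  obtain V L where V: "x \<in> V" "bilip_on X Y f V L"
    using assms(1) by (auto elim: bilip_atE)
  obtain V' L' where V': "f x \<in> V'" "bilip_on Y Z g V' L'"
    using assms(2) unfolding bilip_at_def by blast
  have "x \<in> {v \<in> V. f v \<in> V'}" using V V' by simp
  from bilip_atI[OF this bilip_on_compose[OF V(2) V'(2)]]
  show ?thesis by (simp add: comp_def)
qed

lemma bilip_at_inverse:
  assumes "bilip_at X Y f x" "openin (mtopology_of X) S" "x \<in> S" "\<And>v. v \<in> S \<Longrightarrow> g (f v) = v"
  shows "bilip_at Y X g (f x)"
proof -
  obtain V L where V: "x \<in> V" "bilip_on X Y f V L" using assms(1) by (auto elim: bilip_atE)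
  then have "bilip_on X Y f (V \<inter> S) L"
    by (simp add: bilip_on_Int[OF V(2) assms(2)])
  then have "bilip_on Y X g (f ` (V \<inter> S)) L" using assms(4) by (rule bilip_on_inverse) blast
  then show ?thesis using V assms(3) by (intro bilip_atI[of "f x" "f ` (V \<inter> S)"]) auto
qed

lemma bilip_at_submetric_dom:
  assumes S: "openin (mtopology_of X) S" "x \<in> S"
  shows "bilip_at (submetric X S) Y f x \<longleftrightarrow> bilip_at X Y f x"
proof
  assume "bilip_at (submetric X S) Y f x"
  then obtain V L where V: "x \<in> V" "bilip_on (submetric X S) Y f V L" by (auto simp: bilip_at_def)
  then have "V \<subseteq> S" using bilip_on_subset by fastforce
  then have "bilip_on X Y f V L" using V(2) by (simp add: bilip_on_submetric_dom[OF S(1)])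
  with V(1) show "bilip_at X Y f x" by (rule bilip_atI)
next
  assume "bilip_at X Y f x"
  then obtain V L where V: "x \<in> V" "bilip_on X Y f V L" by (auto simp: bilip_at_def)
  then have "bilip_on X Y f (V \<inter> S) L"
    using bilip_on_Int[OF V(2)] S by simp
  then have "bilip_on (submetric X S) Y f (V \<inter> S) L"
    by (simp add: bilip_on_submetric_dom[OF S(1)])
  with V(1) S(2) show "bilip_at (submetric X S) Y f x" by (auto intro: bilip_atI)
qed

lemma bilip_at_submetric_cod:
  assumes "bilip_at X Y f x" "openin (mtopology_of X) T" "x \<in> T" "f ` T \<subseteq> S"
  shows "bilip_at X (submetric Y S) f x"
proof -
  obtain V L where V: "x \<in> V" "bilip_on X Y f V L" using assms(1) by (auto elim: bilip_atE)
  then have "bilip_on X Y f (V \<inter> T) L"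
    by (simp add: bilip_on_Int[OF V(2) assms(2)])
  then have "bilip_on X (submetric Y S) f (V \<inter> T) L"
    using assms(4) by (intro bilip_on_submetric_cod) auto
  then show ?thesis using V assms(3) by (intro bilip_atI[of x "V \<inter> T"]) auto
qed

lemma bilip_at_submetric_cod_open:
  "bilip_at X (submetric Y S) f x \<Longrightarrow> openin (mtopology_of Y) S \<Longrightarrow> bilip_at X Y f x"
  by (auto elim!: bilip_atE intro: bilip_atI bilip_on_submetric_cod_open)

lemma bilip_at_preimage:
  assumes S: "openin (mtopology_of X) S" and f: "\<And>x. x \<in> S \<Longrightarrow> bilip_at X Y f x"
    and T: "openin (mtopology_of Y) T"
  shows "openin (mtopology_of X) {x \<in> S. f x \<in> T}"
proof (subst openin_subopen, intro ballI)
  fix x assume x: "x \<in> {x \<in> S. f x \<in> T}"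
  then obtain V L where V: "x \<in> V" "bilip_on X Y f V L" using f[of x] by (auto elim: bilip_atE)
  then have "bilip_on X Y f (V \<inter> S) L"
    using bilip_on_Int[OF V(2)] S by simp
  then have "openin (mtopology_of X) {v \<in> V \<inter> S. f v \<in> T}" by (rule bilip_on_preimage[OF _ T])
  then show "\<exists>T'. openin (mtopology_of X) T' \<and> x \<in> T' \<and> T' \<subseteq> {x \<in> S. f x \<in> T}"
    using x V by (intro exI[of _ "{v \<in> V \<inter> S. f v \<in> T}"]) auto
qed

lemma bilip_at_image:
  assumes S: "openin (mtopology_of X) S" and f: "\<And>x. x \<in> S \<Longrightarrow> bilip_at X Y f x"
  shows "openin (mtopology_of Y) (f ` S)"
proof (subst openin_subopen, intro ballI)
  fix y assume "y \<in> f ` S"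
  then obtain x where x: "x \<in> S" "y = f x" by blast
  then obtain V L where V: "x \<in> V" "bilip_on X Y f V L" using f[of x] by (auto elim: bilip_atE)
  then have "bilip_on X Y f (V \<inter> S) L"
    using bilip_on_Int[OF V(2)] S by simp
  then have "openin (mtopology_of Y) (f ` (V \<inter> S))" by (rule bilip_on_image_openin)
  then show "\<exists>T. openin (mtopology_of Y) T \<and> y \<in> T \<and> T \<subseteq> f ` S"
    using x V by (intro exI[of _ "f ` (V \<inter> S)"]) auto
qed

lemma bilip_at_in_mspace:
  assumes "bilip_at X Y f x"
  shows "x \<in> mspace X" "f x \<in> mspace Y"
proof -
  obtain V L where V: "x \<in> V" "bilip_on X Y f V L" using assms by (rule bilip_atE)
  then show "x \<in> mspace X" using bilip_on_subset[OF V(2)] by blast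
  show "f x \<in> mspace Y" by (rule bilip_on_image[OF V(2,1)])
qed

lemma openin_Collect_bilip_at: "openin (mtopology_of X) {x. bilip_at X Y f x}"
proof (subst openin_subopen, clarify)
  fix x assume "bilip_at X Y f x"
  then obtain V L where V: "x \<in> V" "bilip_on X Y f V L" by (rule bilip_atE)
  then show "\<exists>T. openin (mtopology_of X) T \<and> x \<in> T \<and> T \<subseteq> {x. bilip_at X Y f x}"
    using bilip_on_openin bilip_atI by (intro exI[of _ V]) auto
qed

section \<open>Pointwise description of open Lipschitz embeddings\<close>

lemma lipschitz_constant:
  assumes "Lipschitz_continuous_map (submetric X S) Y f" "S \<subseteq> mspace X"
  obtains L where "L > 0" "\<And>u v. u \<in> S \<Longrightarrow> v \<in> S \<Longrightarrow> mdist Y (f u) (f v) \<le> L * mdist X u v"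
proof -
  have "S \<inter> mspace X = S" using assms(2) by blast
  then obtain L where "L > 0" "\<forall>u\<in>S. \<forall>v\<in>S. mdist Y (f u) (f v) \<le> L * mdist X u v"
    using assms(1) by (auto simp: Lipschitz_continuous_map_pos)
  then show thesis using that by blast
qed

lemma Lipschitz_continuous_mapI:
  assumes "\<And>x. x \<in> mspace X \<Longrightarrow> f x \<in> mspace Y"
    and "\<And>x y. x \<in> mspace X \<Longrightarrow> y \<in> mspace X \<Longrightarrow> mdist Y (f x) (f y) \<le> L * mdist X x y"
  shows "Lipschitz_continuous_map X Y f"
  unfolding Lipschitz_continuous_map_def using assms by (intro conjI exI[of _ L]) auto

text \<open>All later work with embeddings goes through this criterion. Forwards, a neighborhood on
  which \<open>f\<close> is Lipschitz is cut down to the part that \<open>f\<close> sends into a set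
  on which the inverse is Lipschitz. Backwards, a local inverse is defined on an open set, so the
  restrictions of the global inverse to these sets show that it is locally Lipschitz.\<close>

lemma open_lipschitz_embedding_iff:
  "open_lipschitz_embedding X Y f \<longleftrightarrow>
     inj_on f (mspace X) \<and> (\<forall>x\<in>mspace X. bilip_at X Y f x)"
proof
  assume f: "open_lipschitz_embedding X Y f"
  then have fim: "f \<in> mspace X \<rightarrow> mspace Y" and inj: "inj_on f (mspace X)"
    and lf: "lipschitz_map X (submetric Y (f ` mspace X)) f"
    and lg: "lipschitz_map (submetric Y (f ` mspace X)) X (inv_into (mspace X) f)"
    and om: "open_map (mtopology_of X) (mtopology_of Y) f"
    by (auto simp: open_lipschitz_embedding_def lipschitz_embedding_def)
  have "bilip_at X Y f x" if x: "x \<in> mspace X" for x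
  proof -
    obtain V1 where V1: "openin (mtopology_of X) V1" "x \<in> V1"
      "Lipschitz_continuous_map (submetric X V1) (submetric Y (f ` mspace X)) f"
      using lf x unfolding lipschitz_map_def by blast
    have V1s: "V1 \<subseteq> mspace X" using V1(1) by (rule openin_mtopology_of_subset)
    obtain L1 where L1: "L1 > 0" "\<And>u v. u \<in> V1 \<Longrightarrow> v \<in> V1 \<Longrightarrow> mdist Y (f u) (f v) \<le> L1 * mdist X u v"
      using lipschitz_constant[OF V1(3) V1s] unfolding mdist_submetric by metis
    have "f x \<in> mspace (submetric Y (f ` mspace X))" using x fim by auto
    then obtain V2 where V2: "openin (mtopology_of (submetric Y (f ` mspace X))) V2" "f x \<in> V2"
      "Lipschitz_continuous_map (submetric (submetric Y (f ` mspace X)) V2) X (inv_into (mspace X) f)"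
      using lg unfolding lipschitz_map_def by blast
    have V2s: "V2 \<subseteq> f ` mspace X" "V2 \<subseteq> mspace Y"
      using openin_mtopology_of_subset[OF V2(1)] by auto
    from V2s have V2m: "V2 \<subseteq> mspace (submetric Y (f ` mspace X))" by auto
    obtain L2 where L2: "L2 > 0" "\<And>u v. u \<in> V2 \<Longrightarrow> v \<in> V2 \<Longrightarrow>
        mdist X (inv_into (mspace X) f u) (inv_into (mspace X) f v) \<le> L2 * mdist Y u v"
      using lipschitz_constant[OF V2(3) V2m] unfolding mdist_submetric by metis
    \<comment> \<open>\<open>V2\<close> is open only relative to the image of \<open>f\<close>; its
      preimage in \<open>V1\<close> is that of the genuinely open set \<open>T\<close>.\<close>
    obtain T where T: "openin (mtopology_of Y) T" "V2 = T \<inter> f ` mspace X"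
      using V2(1) by (auto simp: mtopology_of_submetric openin_subtopology)
    have "continuous_map (mtopology_of (submetric X V1)) (mtopology_of (submetric Y (f ` mspace X))) f"
      by (rule Lipschitz_continuous_imp_continuous_map[OF V1(3)])
    then have "continuous_map (subtopology (mtopology_of X) V1) (mtopology_of Y) f"
      by (simp add: mtopology_of_submetric continuous_map_in_subtopology)
    from openin_continuous_map_preimage[OF this T(1)]
    have op: "openin (mtopology_of X) {v \<in> V1. f v \<in> T}"
      using V1(1) V1s by (simp add: openin_open_subtopology inf_absorb2)
    have "mdist X u v \<le> L2 * mdist Y (f u) (f v)"
      if "u \<in> V1" "f u \<in> T" "v \<in> V1" "f v \<in> T" for u v
    proof -
      have "u \<in> mspace X" "v \<in> mspace X" using that V1s by auto
      then show ?thesis using L2(2)[of "f u" "f v"] that T(2) inj by auto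
    qed
    note le2 = this
    have max: "L1 * r \<le> max L1 L2 * r" "L2 * r \<le> max L1 L2 * r" if "0 \<le> r" for r
      using that by (auto intro: mult_right_mono)
    have "bilip_on X Y f {v \<in> V1. f v \<in> T} (max L1 L2)"
      unfolding bilip_on_def
    proof (intro conjI allI impI ballI)
      show "0 < max L1 L2" using L1(1) by simp
      show "openin (mtopology_of Y) (f ` W)" if "openin (mtopology_of X) W" for W
        using om that by (simp add: open_map_def)
      fix u v assume "u \<in> {v \<in> V1. f v \<in> T}" "v \<in> {v \<in> V1. f v \<in> T}"
      then have uv: "u \<in> V1" "f u \<in> T" "v \<in> V1" "f v \<in> T" by auto
      show "mdist Y (f u) (f v) \<le> max L1 L2 * mdist X u v"
        by (rule order_trans[OF L1(2)[OF uv(1,3)] max(1)]) simp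
      show "mdist X u v \<le> max L1 L2 * mdist Y (f u) (f v)"
        by (rule order_trans[OF le2[OF uv] max(2)]) simp
    qed (rule op)
    then show ?thesis using V1(2) V2(2) T(2)
      by (intro bilip_atI[of x "{v \<in> V1. f v \<in> T}"]) auto
  qed
  with inj show "inj_on f (mspace X) \<and> (\<forall>x\<in>mspace X. bilip_at X Y f x)" by blast
next
  assume f: "inj_on f (mspace X) \<and> (\<forall>x\<in>mspace X. bilip_at X Y f x)"
  let ?g = "inv_into (mspace X) f"
  have fim: "f \<in> mspace X \<rightarrow> mspace Y" using f bilip_at_in_mspace(2)[of X Y f] by blast
  have ex: "\<exists>V L. x \<in> V \<and> bilip_on X Y f V L" if "x \<in> mspace X" for x
    using f that unfolding bilip_at_def[symmetric] by simp
  have "lipschitz_map X (submetric Y (f ` mspace X)) f"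
    unfolding lipschitz_map_def
  proof
    fix x assume "x \<in> mspace X"
    from ex[OF this] obtain V L where V: "x \<in> V" "bilip_on X Y f V L" by blast
    note sub = bilip_on_subset[OF V(2)]
    have "V \<inter> mspace X = V" using sub by blast
    then have "Lipschitz_continuous_map (submetric X V) (submetric Y (f ` mspace X)) f"
      using sub fim bilip_on_mdist_le(1)[OF V(2)] by (intro Lipschitz_continuous_mapI[of _ _ _ L]) auto
    then show "\<exists>V. openin (mtopology_of X) V \<and> x \<in> V \<and>
        Lipschitz_continuous_map (submetric X V) (submetric Y (f ` mspace X)) f"
      using V(1) bilip_on_openin[OF V(2)] by blast
  qed
  moreover have "lipschitz_map (submetric Y (f ` mspace X)) X ?g"
    unfolding lipschitz_map_def
  proof
    fix y assume "y \<in> mspace (submetric Y (f ` mspace X))"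
    then obtain x where x: "x \<in> mspace X" "y = f x" by auto
    from ex[OF x(1)] obtain V L where V: "x \<in> V" "bilip_on X Y f V L" by blast
    note sub = bilip_on_subset[OF V(2)]
    have gf: "?g (f v) = v" if "v \<in> V" for v using that sub f by (simp add: subset_iff)
    have g: "bilip_on Y X ?g (f ` V) L" by (rule bilip_on_inverse[OF V(2) gf])
    have "f ` V = f ` V \<inter> f ` mspace X" using sub by blast
    then have "openin (mtopology_of (submetric Y (f ` mspace X))) (f ` V)"
      using bilip_on_openin[OF g] unfolding mtopology_of_submetric openin_subtopology by blast
    moreover have "Lipschitz_continuous_map (submetric Y (f ` mspace X \<inter> f ` V)) X ?g"
      using sub gf bilip_on_mdist_le(1)[OF g] by (intro Lipschitz_continuous_mapI[of _ _ _ L]) auto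
    ultimately show "\<exists>V. openin (mtopology_of (submetric Y (f ` mspace X))) V \<and> y \<in> V \<and>
        Lipschitz_continuous_map (submetric (submetric Y (f ` mspace X)) V) X ?g"
      using x V(1) by (intro exI[of _ "f ` V"]) simp
  qed
  moreover have "open_map (mtopology_of X) (mtopology_of Y) f"
    unfolding open_map_def
  proof (intro allI impI)
    fix U assume U: "openin (mtopology_of X) U"
    then have "U \<subseteq> mspace X" by (rule openin_mtopology_of_subset)
    then show "openin (mtopology_of Y) (f ` U)" using f by (intro bilip_at_image[OF U]) blast
  qed
  ultimately show "open_lipschitz_embedding X Y f"
    using f fim by (simp add: open_lipschitz_embedding_def lipschitz_embedding_def)
qed

lemma open_lipschitz_embedding_submetric_iff:
  assumes "openin (mtopology_of X) S"
  shows "open_lipschitz_embedding (submetric X S) Y f \<longleftrightarrow>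
     inj_on f S \<and> (\<forall>x\<in>S. bilip_at X Y f x)"
proof -
  have "S \<inter> mspace X = S" using openin_mtopology_of_subset[OF assms] by blast
  then show ?thesis
    by (simp add: open_lipschitz_embedding_iff bilip_at_submetric_dom[OF assms])
qed

subsection \<open>Sum metrics and compact sets\<close>

lemma openin_sum_metric:
  "openin (mtopology_of (sum_metric M N)) W \<longleftrightarrow>
     W \<subseteq> mspace M \<times> mspace N \<and>
     (\<forall>x y. (x, y) \<in> W \<longrightarrow> (\<exists>r>0. \<forall>x'\<in>mspace M. \<forall>y'\<in>mspace N.
        mdist M x x' + mdist N y y' < r \<longrightarrow> (x', y') \<in> W))"
  by (simp add: openin_mtopology_of Ball_def split_paired_all imp_conjL)

lemma mdist_self: "x \<in> mspace M \<Longrightarrow> mdist M x x = 0"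
  by simp

lemma openin_mball_of: "openin (mtopology_of M) (mball_of M x r)"
  by (simp add: mball_of_def mtopology_of_def Metric_space.openin_mball)

text \<open>Makes the tube lemma \<open>Wallace_theorem_prod_topology\<close> and compactness of
  products available for sum metrics. Two balls of half the radius span a box inside a ball, and the
  smaller of two radii gives a ball inside a box.\<close>

lemma mtopology_of_sum_metric:
  "mtopology_of (sum_metric M N) = prod_topology (mtopology_of M) (mtopology_of N)"
  unfolding topology_eq
proof (intro allI iffI)
  fix W assume W: "openin (mtopology_of (sum_metric M N)) W"
  show "openin (prod_topology (mtopology_of M) (mtopology_of N)) W"
    unfolding openin_prod_topology_alt
  proof (intro allI impI)
    fix x y assume xy: "(x, y) \<in> W"
    then have m: "x \<in> mspace M" "y \<in> mspace N"
      using W by (auto simp: openin_sum_metric)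
    obtain r where r: "r > 0" "\<And>x' y'. x' \<in> mspace M \<Longrightarrow> y' \<in> mspace N \<Longrightarrow>
        mdist M x x' + mdist N y y' < r \<Longrightarrow> (x', y') \<in> W"
      using W xy unfolding openin_sum_metric by blast
    show "\<exists>U V. openin (mtopology_of M) U \<and> openin (mtopology_of N) V \<and> x \<in> U \<and> y \<in> V \<and> U \<times> V \<subseteq> W"
      using r m by (intro exI[of _ "mball_of M x (r/2)"] exI[of _ "mball_of N y (r/2)"])
        (auto simp: openin_mball_of mdist_self)
  qed
next
  fix W assume W: "openin (prod_topology (mtopology_of M) (mtopology_of N)) W"
  show "openin (mtopology_of (sum_metric M N)) W"
    unfolding openin_sum_metric
  proof (intro conjI allI impI)
    show "W \<subseteq> mspace M \<times> mspace N" using openin_subset[OF W] by simp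
    fix x y assume "(x, y) \<in> W"
    from W[unfolded openin_prod_topology_alt, rule_format, OF this]
    obtain U V where UV: "openin (mtopology_of M) U" "openin (mtopology_of N) V"
      "x \<in> U" "y \<in> V" "U \<times> V \<subseteq> W"
      by blast
    obtain r where r: "r > 0" "\<And>x'. x' \<in> mspace M \<Longrightarrow> mdist M x x' < r \<Longrightarrow> x' \<in> U"
      by (rule openin_mtopology_ofE[OF UV(1,3)]) blast
    obtain s where s: "s > 0" "\<And>y'. y' \<in> mspace N \<Longrightarrow> mdist N y y' < s \<Longrightarrow> y' \<in> V"
      by (rule openin_mtopology_ofE[OF UV(2,4)]) blast
    have "(x', y') \<in> W" if "x' \<in> mspace M" "y' \<in> mspace N"
      "mdist M x x' + mdist N y y' < min r s" for x' y'
    proof -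
      have "mdist M x x' < r" "mdist N y y' < s"
        using that(3) mdist_nonneg[of M x x'] mdist_nonneg[of N y y'] by linarith+
      then show ?thesis using r(2) s(2) that(1,2) UV(5) by blast
    qed
    then show "\<exists>r>0. \<forall>x'\<in>mspace M. \<forall>y'\<in>mspace N.
        mdist M x x' + mdist N y y' < r \<longrightarrow> (x', y') \<in> W"
      using r(1) s(1) by (intro exI[of _ "min r s"]) simp
  qed
qed

lemma openin_sum_metric_Times:
  "openin (mtopology_of M) U \<Longrightarrow> openin (mtopology_of N) V \<Longrightarrow>
     openin (mtopology_of (sum_metric M N)) (U \<times> V)"
  by (simp add: mtopology_of_sum_metric openin_prod_Times_iff)

text \<open>An equality of metrics and not merely of topologies, because restriction keeps the
  distance function. It turns the domain of a chart into a subset of one fixed product.\<close>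

lemma sum_metric_submetric:
  "sum_metric (submetric M S) (submetric N T) = submetric (sum_metric M N) (S \<times> T)"
proof -
  have "mdist (sum_metric M N) = (\<lambda>(x, y) (x', y'). mdist M x x' + mdist N y y')"
    by (auto simp: fun_eq_iff)
  moreover have "submetric (sum_metric M N) (S \<times> T) =
      metric ((S \<inter> mspace M) \<times> (T \<inter> mspace N), mdist (sum_metric M N))"
    by (simp add: submetric_def Times_Int_Times)
  ultimately show ?thesis
    by (simp add: sum_metric_def[of "submetric M S"])
qed

lemma openin_sum_metric_slice:
  assumes W: "openin (mtopology_of (sum_metric M N)) W" and t: "t \<in> mspace M"
  shows "openin (mtopology_of N) {y. (t, y) \<in> W}"
  unfolding openin_mtopology_of
proof (intro conjI ballI)
  show "{y. (t, y) \<in> W} \<subseteq> mspace N"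
    using W unfolding openin_sum_metric by blast
  fix y assume "y \<in> {y. (t, y) \<in> W}"
  then obtain r where "r > 0" "\<And>x' y'. x' \<in> mspace M \<Longrightarrow> y' \<in> mspace N \<Longrightarrow>
        mdist M t x' + mdist N y y' < r \<Longrightarrow> (x', y') \<in> W"
    using W unfolding openin_sum_metric by blast
  then show "\<exists>r>0. \<forall>z\<in>mspace N. mdist N y z < r \<longrightarrow> z \<in> {y. (t, y) \<in> W}"
    using t by (intro exI[of _ r]) (simp add: mdist_self)
qed

text \<open>Charts carry the parameter in the second factor and isotopies in the first; this
  isometry passes between the two conventions.\<close>

lemma bilip_at_swap:
  assumes "x \<in> mspace M" "y \<in> mspace N"
  shows "bilip_at (sum_metric M N) (sum_metric N M) prod.swap (x, y)"
proof -
  have "openin (mtopology_of (sum_metric N M)) (prod.swap ` W)"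
    if W: "openin (mtopology_of (sum_metric M N)) W" for W
  proof -
    have "prod.swap ` W = {(y, x). (x, y) \<in> W}" by force
    moreover have "\<exists>r>0. \<forall>y'\<in>mspace N. \<forall>x'\<in>mspace M.
        mdist N y y' + mdist M x x' < r \<longrightarrow> (x', y') \<in> W" if "(x, y) \<in> W" for x y
    proof -
      obtain r where "r > 0" "\<forall>x'\<in>mspace M. \<forall>y'\<in>mspace N.
          mdist M x x' + mdist N y y' < r \<longrightarrow> (x', y') \<in> W"
        using W \<open>(x, y) \<in> W\<close> unfolding openin_sum_metric by blast
      then show ?thesis by (intro exI[of _ r]) (simp add: add.commute)
    qed
    moreover have "W \<subseteq> mspace M \<times> mspace N" using W unfolding openin_sum_metric by blast
    ultimately show ?thesis unfolding openin_sum_metric by auto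
  qed
  moreover have "openin (mtopology_of (sum_metric M N)) (mspace M \<times> mspace N)"
    using openin_topspace[of "mtopology_of (sum_metric M N)"] by simp
  ultimately have "bilip_on (sum_metric M N) (sum_metric N M) prod.swap (mspace M \<times> mspace N) 1"
    by (simp add: bilip_on_def split_beta add.commute)
  then show ?thesis using assms by (intro bilip_atI[of "(x, y)"]) auto
qed

lemma bilip_at_slice:
  assumes "bilip_at (sum_metric A B) (sum_metric A C) (\<lambda>(t, x). (t, h t x)) (t, x)"
  shows "bilip_at B C (h t) x"
proof -
  let ?H = "\<lambda>(t, x). (t, h t x)"
  obtain V L where V: "(t, x) \<in> V" "bilip_on (sum_metric A B) (sum_metric A C) ?H V L"
    using assms by (auto elim: bilip_atE)
  have t: "t \<in> mspace A" using bilip_at_in_mspace(1)[OF assms] by simp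
  have "bilip_on B C (h t) {y. (t, y) \<in> V} L"
    unfolding bilip_on_def
  proof (intro conjI allI impI ballI)
    show "openin (mtopology_of B) {y. (t, y) \<in> V}"
      by (rule openin_sum_metric_slice[OF bilip_on_openin[OF V(2)] t])
    show "0 < L" using V(2) by (simp add: bilip_on_def)
    fix W assume W: "W \<subseteq> {y. (t, y) \<in> V}" "openin (mtopology_of B) W"
    have "openin (mtopology_of (sum_metric A B)) (V \<inter> mspace A \<times> W)"
      using bilip_on_openin[OF V(2)] W(2) openin_topspace[of "mtopology_of A"]
      by (intro openin_Int openin_sum_metric_Times) simp_all
    then have "openin (mtopology_of (sum_metric A C)) (?H ` (V \<inter> mspace A \<times> W))"
      by (intro bilip_on_open_image[OF V(2)]) auto
    from openin_sum_metric_slice[OF this t]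
    have "openin (mtopology_of C) {y. (t, y) \<in> ?H ` (V \<inter> mspace A \<times> W)}" .
    moreover have "{y. (t, y) \<in> ?H ` (V \<inter> mspace A \<times> W)} = h t ` W"
      using W(1) t by (force simp: image_iff)
    ultimately show "openin (mtopology_of C) (h t ` W)" by simp
  next
    fix u v assume "u \<in> {y. (t, y) \<in> V}" "v \<in> {y. (t, y) \<in> V}"
    then show "mdist C (h t u) (h t v) \<le> L * mdist B u v" "mdist B u v \<le> L * mdist C (h t u) (h t v)"
      using bilip_on_mdist_le[OF V(2), of "(t, u)" "(t, v)"] t by (simp_all add: mdist_self)
  qed
  with V(1) show ?thesis by (intro bilip_atI[of x]) auto
qed

text \<open>The elementary half of the exponential law, localized at \<open>b\<close>:
  \<open>cont\<close> is joint continuity of the family, and it yields continuity into the function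
  space. The induction over generated open sets reduces this to a subbasic set, where it is the tube
  lemma around \<open>{b} \<times> K\<close>.\<close>

lemma compact_open_topology_nhd:
  assumes T: "openin (compact_open_topology W Y) T" "\<phi> b \<in> T"
    and N: "openin X N" "b \<in> N"
    and ext: "\<And>t. t \<in> N \<Longrightarrow> \<phi> t \<in> topspace (compact_open_topology W Y)"
    and cont: "\<And>V. openin Y V \<Longrightarrow>
      openin (prod_topology X W) {(t, x). t \<in> N \<and> x \<in> topspace W \<and> \<phi> t x \<in> V}"
  shows "\<exists>N'. openin X N' \<and> b \<in> N' \<and> N' \<subseteq> N \<and> (\<forall>t\<in>N'. \<phi> t \<in> T)"
proof -
  let ?S = "{{f \<in> extensional (topspace W). continuous_map W Y f \<and> f ` K \<subseteq> V} | K V.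
          compactin W K \<and> openin Y V}"
  have "generate_topology_on ?S T"
    using T(1) unfolding compact_open_topology_def by (rule openin_topology_generated_by)
  then show ?thesis using T(2)
  proof induction
    case Empty
    then show ?case by simp
  next
    case (Int S1 S2)
    then obtain N1 N2 where "openin X N1" "b \<in> N1" "N1 \<subseteq> N" "\<forall>t\<in>N1. \<phi> t \<in> S1"
      "openin X N2" "b \<in> N2" "\<forall>t\<in>N2. \<phi> t \<in> S2"
      by auto
    then show ?case by (intro exI[of _ "N1 \<inter> N2"]) auto
  next
    case (UN \<K>)
    then obtain S where "S \<in> \<K>" "\<phi> b \<in> S" by auto
    from UN.IH[OF this] obtain N' where "openin X N'" "b \<in> N'" "N' \<subseteq> N" "\<forall>t\<in>N'. \<phi> t \<in> S"
      by blast
    then show ?case using \<open>S \<in> \<K>\<close> by (intro exI[of _ N']) auto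
  next
    case (Basis S)
    then obtain K V where S: "S = {f \<in> extensional (topspace W). continuous_map W Y f \<and> f ` K \<subseteq> V}"
      and K: "compactin W K" and V: "openin Y V"
      by auto
    have KW: "K \<subseteq> topspace W" by (rule compactin_subset_topspace[OF K])
    have b: "compactin X {b}" using openin_subset[OF N(1)] N(2) by auto
    have sub: "{b} \<times> K \<subseteq> {(t, x). t \<in> N \<and> x \<in> topspace W \<and> \<phi> t x \<in> V}"
      using Basis.prems KW N(2) unfolding S by auto
    obtain N' K' where N': "openin X N'" "openin W K'" "{b} \<subseteq> N'" "K \<subseteq> K'"
      "N' \<times> K' \<subseteq> {(t, x). t \<in> N \<and> x \<in> topspace W \<and> \<phi> t x \<in> V}"
      by (rule Wallace_theorem_prod_topology[OF b K cont[OF V] sub])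
    \<comment> \<open>\<open>K\<close> may be empty. Then \<open>K'\<close> may be empty too, and
      the tube says nothing about \<open>N'\<close>; hence the intersection with
      \<open>N\<close>.\<close>
    show ?case
    proof (intro exI[of _ "N' \<inter> N"] conjI ballI)
      fix t assume t: "t \<in> N' \<inter> N"
      then have "\<phi> t ` K \<subseteq> V" using N' by auto
      then show "\<phi> t \<in> S" using ext[of t] t unfolding S by simp
    qed (use N N' in auto)
  qed
qed

text \<open>Injectivity is a condition on pairs, so compactness is applied to
  \<open>K \<times> K\<close>. A pair on the diagonal has a good neighborhood by local injectivity,
  a pair off the diagonal because its two images can be separated.\<close>

lemma inj_on_nhd_of_compact:
  assumes K: "compactin (mtopology_of X) K" and f: "\<And>z. z \<in> K \<Longrightarrow> bilip_at X Y f z"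
    and inj: "inj_on f K"
  shows "\<exists>S. openin (mtopology_of X) S \<and> K \<subseteq> S \<and> inj_on f S"
proof -
  define S where "S = {z. bilip_at X Y f z}"
  have S: "openin (mtopology_of X) S" unfolding S_def by (rule openin_Collect_bilip_at)
  define sep where "sep V V' \<longleftrightarrow> openin (mtopology_of X) V \<and> openin (mtopology_of X) V' \<and>
      (\<forall>z\<in>V. \<forall>w\<in>V'. f z = f w \<longrightarrow> z = w)" for V V'
  \<comment> \<open>An open set of pairs on which equal values force equal arguments. A box in
    \<open>W\<close> around \<open>K \<times> K\<close> may have two different sides, so their
    intersection is the set on which \<open>f\<close> is injective.\<close>
  define W where "W = \<Union>{V \<times> V' | V V'. sep V V'}"
  have W: "openin (prod_topology (mtopology_of X) (mtopology_of X)) W"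
    unfolding W_def sep_def by (intro openin_Union) (auto simp: openin_prod_Times_iff)
  have "\<exists>V V'. sep V V' \<and> z \<in> V \<and> w \<in> V'" if zw: "z \<in> K" "w \<in> K" for z w
  proof (cases "z = w")
    case True
    obtain V L where V: "z \<in> V" "bilip_on X Y f V L"
      using f[OF zw(1)] by (auto elim: bilip_atE)
    then have "sep V V"
      using bilip_on_inj_on[OF V(2)] bilip_on_openin[OF V(2)] unfolding sep_def inj_on_def by blast
    then show ?thesis using V True by blast
  next
    case False
    then have "f z \<noteq> f w" using inj zw by (auto dest: inj_onD)
    moreover have "f z \<in> mspace Y" "f w \<in> mspace Y"
      by (rule bilip_at_in_mspace(2)[OF f[OF zw(1)]], rule bilip_at_in_mspace(2)[OF f[OF zw(2)]])
    ultimately obtain T T' where T: "openin (mtopology_of Y) T" "openin (mtopology_of Y) T'"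
      "f z \<in> T" "f w \<in> T'" "disjnt T T'"
      using Hausdorff_space_mtopology_of[of Y, unfolded Hausdorff_space_def, rule_format, of "f z" "f w"]
      by auto
    have "openin (mtopology_of X) {x \<in> S. f x \<in> T}" "openin (mtopology_of X) {x \<in> S. f x \<in> T'}"
      by (rule bilip_at_preimage[OF S _ T(1)] bilip_at_preimage[OF S _ T(2)], simp add: S_def)+
    moreover have "f x \<noteq> f y" if "x \<in> {x \<in> S. f x \<in> T}" "y \<in> {x \<in> S. f x \<in> T'}" for x y
      using that T(5) by (auto simp: disjnt_iff)
    ultimately have "sep {x \<in> S. f x \<in> T} {x \<in> S. f x \<in> T'}"
      unfolding sep_def by blast
    moreover have "z \<in> {x \<in> S. f x \<in> T}" "w \<in> {x \<in> S. f x \<in> T'}"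
      using T zw f by (auto simp: S_def)
    ultimately show ?thesis by blast
  qed
  note sepK = this
  have sub: "K \<times> K \<subseteq> W"
  proof clarify
    fix z w assume zw: "z \<in> K" "w \<in> K"
    from sepK[OF this] obtain V V' where "sep V V'" "z \<in> V" "w \<in> V'" by blast
    then show "(z, w) \<in> W" unfolding W_def by auto
  qed
  obtain V V' where V: "openin (mtopology_of X) V" "openin (mtopology_of X) V'"
    "K \<subseteq> V" "K \<subseteq> V'" "V \<times> V' \<subseteq> W"
    by (rule Wallace_theorem_prod_topology[OF K K W sub])
  have "inj_on f (V \<inter> V')"
  proof
    fix z w assume "z \<in> V \<inter> V'" "w \<in> V \<inter> V'" "f z = f w"
    then have "(z, w) \<in> W" using V by blast
    then obtain V V' where "sep V V'" "z \<in> V" "w \<in> V'" unfolding W_def by auto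
    then show "z = w" using \<open>f z = f w\<close> unfolding sep_def by simp
  qed
  then show ?thesis using V by (intro exI[of _ "V \<inter> V'"]) auto
qed

subsection \<open>Germs of product charts\<close>

lemma mspace_fiber [simp]: "mspace (fiber E p b) = {e \<in> mspace E. p e = b}"
  by (auto simp: fiber_def)

lemma submetric_fiber:
  assumes "U \<subseteq> mspace (fiber E p b)"
  shows "submetric (fiber E p b) U = submetric E U"
proof -
  have "{e \<in> mspace E. p e = b} \<inter> U = U" using assms by auto
  then show ?thesis by (simp add: fiber_def)
qed

text \<open>The conditions are imposed on a whole neighborhood of \<open>z\<close>, which makes
  being a germ an open condition in \<open>z\<close>. The point \<open>z\<close> may lie off the
  central slice, where the last clause is vacuous unless the neighborhood meets that slice.\<close>

definition product_germ ::
  "'e metric \<Rightarrow> 'x metric \<Rightarrow> ('e \<Rightarrow> 'x) \<Rightarrow> 'x \<Rightarrow> ('e \<times> 'x \<Rightarrow> 'e) \<Rightarrow> 'e \<times> 'x \<Rightarrow> bool"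
where
  "product_germ E X p b f z \<longleftrightarrow>
     (\<exists>S. openin (mtopology_of (sum_metric (fiber E p b) X)) S \<and> z \<in> S \<and>
        (\<forall>w\<in>S. bilip_at (sum_metric (fiber E p b) X) E f w \<and> p (f w) = snd w \<and>
           (snd w = b \<longrightarrow> f w = fst w)))"

lemma product_germI:
  assumes "openin (mtopology_of (sum_metric (fiber E p b) X)) S" "z \<in> S"
    and "\<And>w. w \<in> S \<Longrightarrow> bilip_at (sum_metric (fiber E p b) X) E f w"
    and "\<And>w. w \<in> S \<Longrightarrow> p (f w) = snd w" "\<And>w. w \<in> S \<Longrightarrow> snd w = b \<Longrightarrow> f w = fst w"
  shows "product_germ E X p b f z"
  using assms unfolding product_germ_def by (intro exI[of _ S]) simp

lemma product_germD:
  assumes "product_germ E X p b f z"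
  shows "bilip_at (sum_metric (fiber E p b) X) E f z" "p (f z) = snd z" "snd z = b \<Longrightarrow> f z = fst z"
  using assms unfolding product_germ_def by (elim exE conjE, simp)+

lemma openin_Collect_product_germ:
  "openin (mtopology_of (sum_metric (fiber E p b) X)) {z. product_germ E X p b f z}"
proof (subst openin_subopen, clarify)
  fix u x assume "product_germ E X p b f (u, x)"
  then obtain S where S: "openin (mtopology_of (sum_metric (fiber E p b) X)) S" "(u, x) \<in> S"
    "\<forall>w\<in>S. bilip_at (sum_metric (fiber E p b) X) E f w \<and> p (f w) = snd w \<and>
           (snd w = b \<longrightarrow> f w = fst w)"
    unfolding product_germ_def by (elim exE conjE)
  then have "product_germ E X p b f w" if "w \<in> S" for w
    using that by (intro product_germI[of _ _ _ _ S]) auto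
  then show "\<exists>T. openin (mtopology_of (sum_metric (fiber E p b) X)) T \<and> (u, x) \<in> T \<and>
      T \<subseteq> {z. product_germ E X p b f z}"
    using S(1,2) by (intro exI[of _ S]) auto
qed

lemma product_germ_cong:
  assumes f: "product_germ E X p b f z" and S: "openin (mtopology_of (sum_metric (fiber E p b) X)) S"
    and "z \<in> S" and eq: "\<And>w. w \<in> S \<Longrightarrow> f w = g w"
  shows "product_germ E X p b g z"
proof -
  let ?T = "{w. product_germ E X p b f w} \<inter> S"
  have T: "openin (mtopology_of (sum_metric (fiber E p b) X)) ?T"
    using openin_Collect_product_germ S by (rule openin_Int)
  have "bilip_at (sum_metric (fiber E p b) X) E g w \<and> p (g w) = snd w \<and> (snd w = b \<longrightarrow> g w = fst w)"
    if w: "w \<in> ?T" for w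
  proof -
    have germ: "product_germ E X p b f w" and wS: "w \<in> S" using w by auto
    have "bilip_at (sum_metric (fiber E p b) X) E g w"
      by (rule bilip_at_cong[OF product_germD(1)[OF germ] S wS eq])
    then show ?thesis using product_germD(2,3)[OF germ] eq[OF wS] by simp
  qed
  then show ?thesis
    using T f \<open>z \<in> S\<close> by (intro product_germI[of _ _ _ _ ?T]) auto
qed

text \<open>The neighborhood \<open>N\<close> need not be open, so \<open>U \<times> N\<close> need
  not be open in the product and the bounds cannot be transferred from it directly. The smaller set
  \<open>U \<times> N'\<close>, with \<open>N'\<close> the interior, is open both in
  \<open>U \<times> N\<close> and in the full product, and the bounds pass through it.\<close>

lemma chart_imp_product_germ:
  assumes chart: "lipschitz_product_chart E X p b U N f" and u: "u \<in> U"
  shows "product_germ E X p b f (u, b)"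
proof -
  let ?F = "fiber E p b" and ?P = "sum_metric (fiber E p b) X"
  define N' where "N' = mtopology_of X interior_of N"
  have U: "openin (mtopology_of ?F) U" and N: "N \<subseteq> mspace X" "b \<in> N'"
    and ole: "open_lipschitz_embedding (sum_metric (submetric E U) (submetric X N)) E f"
    and proj: "\<And>u x. u \<in> U \<Longrightarrow> x \<in> N \<Longrightarrow> p (f (u, x)) = x"
    and base: "\<And>u. u \<in> U \<Longrightarrow> f (u, b) = u"
    using chart by (simp_all add: lipschitz_product_chart_def N'_def)
  have N': "openin (mtopology_of X) N'" "N' \<subseteq> N"
    unfolding N'_def by (simp_all add: interior_of_subset)
  have sub: "U \<subseteq> mspace ?F" by (rule openin_mtopology_of_subset[OF U])
  have S: "openin (mtopology_of ?P) (U \<times> N')"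
    by (rule openin_sum_metric_Times[OF U N'(1)])
  have dom: "sum_metric (submetric E U) (submetric X N) = submetric ?P (U \<times> N)"
    by (simp add: sum_metric_submetric[symmetric] submetric_fiber[OF sub])
  have UN: "U \<times> N \<inter> (mspace ?F \<times> mspace X) = U \<times> N" using sub N(1) by auto
  have S': "openin (mtopology_of (submetric ?P (U \<times> N))) (U \<times> N')"
    unfolding mtopology_of_submetric using S N'(2)
    by (auto simp: openin_subtopology intro!: exI[of _ "U \<times> N'"])
  have "bilip_at ?P E f w" if w: "w \<in> U \<times> N'" for w
  proof -
    have "w \<in> mspace (submetric ?P (U \<times> N))" using w N'(2) UN by auto
    then have "bilip_at (submetric ?P (U \<times> N)) E f w"
      using ole unfolding dom open_lipschitz_embedding_iff by blast
    then have "bilip_at (submetric (submetric ?P (U \<times> N)) (U \<times> N')) E f w"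
      by (simp only: bilip_at_submetric_dom[OF S' w])
    moreover have "U \<times> N \<inter> U \<times> N' = U \<times> N'" using N'(2) by auto
    ultimately have "bilip_at (submetric ?P (U \<times> N')) E f w"
      by (simp only: submetric_submetric)
    then show ?thesis by (simp only: bilip_at_submetric_dom[OF S w])
  qed
  moreover have "p (f w) = snd w \<and> (snd w = b \<longrightarrow> f w = fst w)" if "w \<in> U \<times> N'" for w
    using that proj base N'(2) by auto
  ultimately show ?thesis
    using S u N(2) by (intro product_germI[of _ _ _ _ "U \<times> N'"]) auto
qed

lemma product_chartI:
  assumes U: "openin (mtopology_of (fiber E p b)) U" and N: "openin (mtopology_of X) N" "b \<in> N"
    and inj: "inj_on f (U \<times> N)" and germ: "\<And>z. z \<in> U \<times> N \<Longrightarrow> product_germ E X p b f z"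
  shows "lipschitz_product_chart E X p b U N f"
proof -
  let ?F = "fiber E p b" and ?P = "sum_metric (fiber E p b) X"
  have sub: "U \<subseteq> mspace ?F" by (rule openin_mtopology_of_subset[OF U])
  have dom: "sum_metric (submetric E U) (submetric X N) = submetric ?P (U \<times> N)"
    by (simp add: sum_metric_submetric[symmetric] submetric_fiber[OF sub])
  have "open_lipschitz_embedding (submetric ?P (U \<times> N)) E f"
    unfolding open_lipschitz_embedding_submetric_iff[OF openin_sum_metric_Times[OF U N(1)]]
    using inj product_germD(1)[OF germ] by blast
  moreover have "p (f (u, x)) = x" if "u \<in> U" "x \<in> N" for u x
    using product_germD(2)[OF germ, of "(u, x)"] that by simp
  moreover have "f (u, b) = u" if "u \<in> U" for u
    using product_germD(3)[OF germ, of "(u, b)"] that N(2) by simp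
  moreover have "mtopology_of X interior_of N = N" "N \<subseteq> mspace X"
    using N(1) openin_mtopology_of_subset by (auto simp: interior_of_openin)
  ultimately show ?thesis
    using U N(2) by (simp add: lipschitz_product_chart_def dom)
qed

text \<open>On \<open>C \<times> {b}\<close> the map is the first projection, hence injective.
  Injectivity and the germ condition both extend to open sets around this compact slice, and the
  tube lemma fits a box into their intersection.\<close>

lemma product_germ_compact:
  assumes b: "b \<in> mspace X" and C: "compactin (mtopology_of (fiber E p b)) C"
    and germ: "\<And>u. u \<in> C \<Longrightarrow> product_germ E X p b f (u, b)"
  obtains U N where "openin (mtopology_of (fiber E p b)) U" "openin (mtopology_of X) N"
    "C \<subseteq> U" "b \<in> N" "inj_on f (U \<times> N)" "\<And>z. z \<in> U \<times> N \<Longrightarrow> product_germ E X p b f z"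
proof -
  let ?F = "fiber E p b" and ?P = "sum_metric (fiber E p b) X"
  have cb: "compactin (mtopology_of X) {b}" using b by simp
  have C': "compactin (mtopology_of ?P) (C \<times> {b})"
    using C cb by (simp add: mtopology_of_sum_metric compactin_Times)
  have germ': "product_germ E X p b f z" if "z \<in> C \<times> {b}" for z
    using that germ by auto
  have "inj_on f (C \<times> {b})"
  proof
    fix z w assume "z \<in> C \<times> {b}" "w \<in> C \<times> {b}" "f z = f w"
    then show "z = w"
      using product_germD(3)[OF germ', of z] product_germD(3)[OF germ', of w] by auto
  qed
  from inj_on_nhd_of_compact[OF C' product_germD(1)[OF germ'] this]
  obtain S where S: "openin (mtopology_of ?P) S" "C \<times> {b} \<subseteq> S" "inj_on f S"
    by blast
  let ?T = "S \<inter> {z. product_germ E X p b f z}"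
  have T: "openin (prod_topology (mtopology_of ?F) (mtopology_of X)) ?T"
    unfolding mtopology_of_sum_metric[symmetric]
    by (rule openin_Int[OF S(1) openin_Collect_product_germ])
  have sub: "C \<times> {b} \<subseteq> ?T" using S(2) germ' by blast
  obtain U N where UN: "openin (mtopology_of ?F) U" "openin (mtopology_of X) N"
    "C \<subseteq> U" "{b} \<subseteq> N" "U \<times> N \<subseteq> ?T"
    by (rule Wallace_theorem_prod_topology[OF C cb T sub])
  show thesis
  proof (rule that[OF UN(1-3)])
    show "b \<in> N" using UN(4) by simp
    show "inj_on f (U \<times> N)" using UN(5) by (intro inj_on_subset[OF S(3)]) blast
    show "product_germ E X p b f z" if "z \<in> U \<times> N" for z using that UN(5) by blast
  qed
qed

text \<open>Local compactness is applied inside the open subspace \<open>S\<close>, which is again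
  locally compact and Hausdorff; this keeps the compact neighborhood in \<open>S\<close>.\<close>

lemma compact_between:
  assumes "locally_compact_space T" "Hausdorff_space T" "compactin T K" "openin T S" "K \<subseteq> S"
  obtains V L where "openin T V" "compactin T L" "K \<subseteq> V" "V \<subseteq> L" "L \<subseteq> S"
proof -
  have "locally_compact_space (subtopology T S)"
    using assms by (intro locally_compact_space_open_subset) auto
  moreover have "Hausdorff_space (subtopology T S)"
    using assms(2) by (rule Hausdorff_space_subtopology)
  moreover have "compactin (subtopology T S) K"
    using assms(3,5) by (simp add: compactin_subtopology)
  ultimately obtain V L where VL: "openin (subtopology T S) V" "compactin (subtopology T S) L"
    "K \<subseteq> V" "V \<subseteq> L"
    using locally_compact_space_compact_closed_compact[of "subtopology T S"] by meson
  have "openin T V" using VL(1) assms(4) by (simp add: openin_open_subtopology)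
  moreover have "compactin T L" "L \<subseteq> S" using VL(2) by (simp_all add: compactin_subtopology)
  ultimately show thesis using that VL(3,4) by blast
qed

subsection \<open>Extending isotopies\<close>

text \<open>Clause (P) is used with the subspace \<open>M'\<close> of \<open>X\<close> as parameter
  space. Two facts have to be prepared: after shrinking \<open>M\<close> the maps
  \<open>\<phi> t\<close> lie in the neighborhood on which the rule is defined, and over
  \<open>M'\<close> they form a Lipschitz isotopy.\<close>

lemma Lstar_extend_isotopy:
  fixes F :: "'a metric" and X :: "'x metric"
  defines "Q \<equiv> sum_metric X F"
  assumes L: "Lstar TYPE('x) F"
    and W: "openin (mtopology_of F) W" and D: "compactin (mtopology_of F) D" "D \<subseteq> W"
    and M: "openin (mtopology_of X) M" "b \<in> M"
    and ext: "\<And>t. t \<in> M \<Longrightarrow> \<phi> t \<in> extensional W"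
    and bl: "\<And>t x. t \<in> M \<Longrightarrow> x \<in> W \<Longrightarrow> bilip_at Q Q (\<lambda>(t, x). (t, \<phi> t x)) (t, x)"
    and inj: "\<And>t. t \<in> M \<Longrightarrow> inj_on (\<phi> t) W"
    and base: "\<phi> b = restrict (\<lambda>x. x) W"
  obtains M' \<Phi> where "openin (mtopology_of X) M'" "b \<in> M'" "M' \<subseteq> M"
    "\<And>t x. t \<in> M' \<Longrightarrow> x \<in> mspace F \<Longrightarrow> bilip_at Q Q (\<lambda>(t, x). (t, \<Phi> t x)) (t, x)"
    "\<And>t x. t \<in> M' \<Longrightarrow> x \<in> D \<Longrightarrow> \<Phi> t x = \<phi> t x"
    "\<And>x. x \<in> mspace F \<Longrightarrow> \<Phi> b x = x"
proof -
  let ?\<Psi> = "\<lambda>(t, x). (t, \<phi> t x)"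
  have WF: "W \<subseteq> mspace F" by (rule openin_mtopology_of_subset[OF W])
  then have WF': "W \<inter> mspace F = W" by blast
  obtain \<N> R where \<N>: "openin (open_lipschitz_embedding_space (submetric F W) F) \<N>"
      "restrict (\<lambda>x. x) W \<in> \<N>"
    and R: "\<And>h x. h \<in> \<N> \<Longrightarrow> x \<in> D \<Longrightarrow> R h x = h x"
      "R (restrict (\<lambda>x. x) W) = restrict (\<lambda>x. x) (mspace F)"
    and P: "\<And>(B :: 'x metric) h. (\<forall>t\<in>mspace B. h t \<in> \<N>) \<Longrightarrow>
        lipschitz_isotopy B (submetric F W) F h \<Longrightarrow> lipschitz_isotopy B F F (\<lambda>t. R (h t))"
  proof -
    have "openin (mtopology_of F) W \<and> compactin (mtopology_of F) D \<and> D \<subseteq> W" using W D by simp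
    from L[unfolded Lstar_def, rule_format, OF this]
    obtain \<N> R where *: "openin (open_lipschitz_embedding_space (submetric F W) F) \<N>"
      "restrict (\<lambda>x. x) W \<in> \<N>"
      "\<forall>h\<in>\<N>. lipschitz_isomorphism F F (R h) \<and>
             (\<forall>x\<in>D. R h x = h x) \<and> (\<forall>x\<in>mspace F - W. R h x = x)"
      "R (restrict (\<lambda>x. x) W) = restrict (\<lambda>x. x) (mspace F)"
      "\<forall>(B :: 'x metric) h. (\<forall>t\<in>mspace B. h t \<in> \<N>) \<and> lipschitz_isotopy B (submetric F W) F h \<longrightarrow>
             lipschitz_isotopy B F F (\<lambda>t. R (h t))"
      by (elim exE conjE)
    show thesis
      by (rule that[of \<N> R]) (use * in \<open>simp_all\<close>)
  qed
  \<comment> \<open>\<open>\<N>\<close> is open only among the open Lipschitz embeddings. Nearness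
    is therefore proved for an open set \<open>T\<close> of the whole function space, and membership
    in \<open>\<N>\<close> follows because each \<open>\<phi> t\<close> is an embedding.\<close>
  obtain T where T: "openin (compact_open_topology (mtopology_of (submetric F W)) (mtopology_of F)) T"
    "\<N> = T \<inter> {h. open_lipschitz_embedding (submetric F W) F h}"
    using \<N>(1) unfolding open_lipschitz_embedding_space_def openin_subtopology by blast
  have emb: "open_lipschitz_embedding (submetric F W) F (\<phi> t)" if t: "t \<in> M" for t
    unfolding open_lipschitz_embedding_submetric_iff[OF W]
    using inj[OF t] bilip_at_slice[OF bl[OF t, unfolded Q_def]] by blast
  have cont: "continuous_map (mtopology_of (submetric F W)) (mtopology_of F) (\<phi> t)" if t: "t \<in> M" for t
    unfolding continuous_map_def
  proof (intro conjI allI impI)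
    have bF: "bilip_at F F (\<phi> t) x" if "x \<in> W" for x
      by (rule bilip_at_slice[OF bl[OF t that, unfolded Q_def]])
    then show "\<phi> t \<in> topspace (mtopology_of (submetric F W)) \<rightarrow> topspace (mtopology_of F)"
      using bilip_at_in_mspace(2)[OF bF] by auto
    fix V assume V: "openin (mtopology_of F) V"
    have "openin (mtopology_of F) {x \<in> W. \<phi> t x \<in> V}"
      by (rule bilip_at_preimage[OF W bF V])
    moreover have "{x \<in> topspace (mtopology_of (submetric F W)). \<phi> t x \<in> V} = {x \<in> W. \<phi> t x \<in> V}"
      using WF by auto
    ultimately show "openin (mtopology_of (submetric F W)) {x \<in> topspace (mtopology_of (submetric F W)). \<phi> t x \<in> V}"
      using W by (auto simp: mtopology_of_submetric openin_open_subtopology)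
  qed
  have MW: "openin (mtopology_of Q) (M \<times> W)"
    unfolding Q_def by (rule openin_sum_metric_Times[OF M(1) W])
  have bl': "bilip_at Q Q ?\<Psi> z" if "z \<in> M \<times> W" for z
    using bl that by auto
  have "\<exists>M'. openin (mtopology_of X) M' \<and> b \<in> M' \<and> M' \<subseteq> M \<and> (\<forall>t\<in>M'. \<phi> t \<in> T)"
  proof (rule compact_open_topology_nhd[OF T(1) _ M])
    show "\<phi> b \<in> T" using \<N>(2) T(2) base by simp
    show "\<phi> t \<in> topspace (compact_open_topology (mtopology_of (submetric F W)) (mtopology_of F))"
      if "t \<in> M" for t
      using ext[OF that] cont[OF that] by (simp add: WF')
    fix V assume V: "openin (mtopology_of F) V"
    let ?S = "{z \<in> M \<times> W. ?\<Psi> z \<in> mspace X \<times> V}"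
    have "openin (mtopology_of X) (mspace X)"
      using openin_topspace[of "mtopology_of X"] by simp
    then have "openin (mtopology_of Q) (mspace X \<times> V)"
      unfolding Q_def using V by (rule openin_sum_metric_Times)
    from bilip_at_preimage[OF MW bl' this]
    have "openin (mtopology_of Q) ?S" .
    moreover have "?S \<subseteq> UNIV \<times> W" by auto
    \<comment> \<open>With \<open>UNIV\<close> in the first factor only the second one is
      restricted, so this subspace is the product of \<open>X\<close> with the subspace
      \<open>W\<close>.\<close>
    ultimately have "openin (subtopology (mtopology_of Q) (UNIV \<times> W)) ?S"
      by (auto simp: openin_subtopology)
    moreover have "subtopology (mtopology_of Q) (UNIV \<times> W) =
        prod_topology (mtopology_of X) (mtopology_of (submetric F W))"
      unfolding Q_def mtopology_of_submetric[symmetric] mtopology_of_sum_metric[symmetric]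
        sum_metric_submetric[symmetric] by simp
    moreover have "{(t, x). t \<in> M \<and> x \<in> topspace (mtopology_of (submetric F W)) \<and> \<phi> t x \<in> V} = ?S"
      using WF openin_mtopology_of_subset[OF M(1)] by auto
    ultimately show "openin (prod_topology (mtopology_of X) (mtopology_of (submetric F W)))
        {(t, x). t \<in> M \<and> x \<in> topspace (mtopology_of (submetric F W)) \<and> \<phi> t x \<in> V}"
      by simp
  qed
  then obtain M' where M': "openin (mtopology_of X) M'" "b \<in> M'" "M' \<subseteq> M" "\<forall>t\<in>M'. \<phi> t \<in> T"
    by blast
  have in\<N>: "\<phi> t \<in> \<N>" if "t \<in> M'" for t
    using that M'(3,4) emb T(2) by auto
  \<comment> \<open>An isotopy over \<open>M'\<close> has target \<open>M' \<times> F\<close> and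
    not \<open>X \<times> F\<close>. The former is an open part of \<open>Q\<close>, so the bounds
    pass in both directions.\<close>
  have cod: "sum_metric (submetric X M') F = submetric Q (M' \<times> mspace F)"
    unfolding Q_def by (simp add: sum_metric_submetric[symmetric])
  have dom: "sum_metric (submetric X M') (submetric F W) = submetric Q (M' \<times> W)"
    unfolding Q_def by (simp add: sum_metric_submetric)
  have M'W: "openin (mtopology_of Q) (M' \<times> W)"
    unfolding Q_def by (rule openin_sum_metric_Times[OF M'(1) W])
  have M'F: "openin (mtopology_of Q) (M' \<times> mspace F)"
    unfolding Q_def using openin_topspace[of "mtopology_of F"]
    by (intro openin_sum_metric_Times[OF M'(1)]) simp
  have "inj_on ?\<Psi> (M' \<times> W)"
    using inj M'(3) by (auto simp: inj_on_def)
  moreover have "?\<Psi> ` (M' \<times> W) \<subseteq> M' \<times> mspace F"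
  proof (rule image_subsetI)
    fix z assume z: "z \<in> M' \<times> W"
    then have "?\<Psi> z \<in> mspace Q" using M'(3) by (intro bilip_at_in_mspace(2)[OF bl']) auto
    then show "?\<Psi> z \<in> M' \<times> mspace F" using z by (auto simp: Q_def)
  qed
  then have "bilip_at Q (submetric Q (M' \<times> mspace F)) ?\<Psi> z" if "z \<in> M' \<times> W" for z
    using that M'(3) by (intro bilip_at_submetric_cod[OF bl' M'W that]) auto
  ultimately have "lipschitz_isotopy (submetric X M') (submetric F W) F \<phi>"
    unfolding lipschitz_isotopy_def dom cod open_lipschitz_embedding_submetric_iff[OF M'W] by blast
  moreover have "\<forall>t\<in>mspace (submetric X M'). \<phi> t \<in> \<N>" using in\<N> by simp
  ultimately have "lipschitz_isotopy (submetric X M') F F (\<lambda>t. R (\<phi> t))"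
    by (intro P)
  then have H: "bilip_at Q (submetric Q (M' \<times> mspace F)) (\<lambda>(t, x). (t, R (\<phi> t) x)) z"
    if "z \<in> M' \<times> mspace F" for z
    unfolding lipschitz_isotopy_def cod open_lipschitz_embedding_submetric_iff[OF M'F] using that by blast
  show thesis
  proof (rule that[OF M'(1-3), of "\<lambda>t. R (\<phi> t)"])
    show "bilip_at Q Q (\<lambda>(t, x). (t, R (\<phi> t) x)) (t, x)" if "t \<in> M'" "x \<in> mspace F" for t x
      by (rule bilip_at_submetric_cod_open[OF H M'F]) (use that in simp)
    show "R (\<phi> t) x = \<phi> t x" if "t \<in> M'" "x \<in> D" for t x
      by (rule R(1)[OF in\<N>[OF that(1)] that(2)])
    show "R (\<phi> b) x = x" if "x \<in> mspace F" for x
      using that by (simp add: base R(2))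
  qed
qed

subsection \<open>Gluing\<close>

text \<open>The family is the fiber coordinate of g^{-1} \<circ> f. Its domain of definition is open
  and contains the slice over \<open>b\<close>, but how far it reaches in the parameter could vary
  with the point; enclosing \<open>W\<close> in the compact \<open>K\<close> gives one parameter
  neighborhood \<open>M\<close> for all of \<open>W\<close>.\<close>

lemma product_germ_transition:
  fixes E :: "'e metric" and X :: "'x metric" and p :: "'e \<Rightarrow> 'x" and b :: 'x
  defines "F \<equiv> fiber E p b"
  defines "Q \<equiv> sum_metric X F"
  assumes U: "openin (mtopology_of F) U" and V: "openin (mtopology_of F) V"
    and N: "openin (mtopology_of X) N" "b \<in> N"
    and f: "inj_on f (U \<times> N)" "\<And>z. z \<in> U \<times> N \<Longrightarrow> product_germ E X p b f z"
    and g: "inj_on g (V \<times> N)" "\<And>z. z \<in> V \<times> N \<Longrightarrow> product_germ E X p b g z"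
    and W: "openin (mtopology_of F) W" and K: "compactin (mtopology_of F) K"
    and sub: "W \<subseteq> K" "K \<subseteq> U \<inter> V"
  obtains M \<phi> where "openin (mtopology_of X) M" "b \<in> M" "M \<subseteq> N"
    "\<And>t. t \<in> M \<Longrightarrow> \<phi> t \<in> extensional W"
    "\<And>t x. t \<in> M \<Longrightarrow> x \<in> W \<Longrightarrow> bilip_at Q Q (\<lambda>(t, x). (t, \<phi> t x)) (t, x)"
    "\<And>t. t \<in> M \<Longrightarrow> inj_on (\<phi> t) W"
    "\<phi> b = restrict (\<lambda>x. x) W"
    "\<And>t x. t \<in> M \<Longrightarrow> x \<in> W \<Longrightarrow> g (\<phi> t x, t) = f (x, t)"
proof -
  let ?P = "sum_metric F X"
  have UN: "openin (mtopology_of ?P) (U \<times> N)" and VN: "openin (mtopology_of ?P) (V \<times> N)"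
    using U V N(1) by (auto intro: openin_sum_metric_Times)
  have fb: "bilip_at ?P E f z" "p (f z) = snd z" "snd z = b \<Longrightarrow> f z = fst z" if "z \<in> U \<times> N" for z
    using product_germD[OF f(2)[OF that]] unfolding F_def by blast+
  have gb: "bilip_at ?P E g z" "p (g z) = snd z" "snd z = b \<Longrightarrow> g z = fst z" if "z \<in> V \<times> N" for z
    using product_germD[OF g(2)[OF that]] unfolding F_def by blast+
  have G: "openin (mtopology_of E) (g ` (V \<times> N))"
    by (rule bilip_at_image[OF VN gb(1)])
  let ?O = "{z \<in> U \<times> N. f z \<in> g ` (V \<times> N)}"
  have O: "openin (prod_topology (mtopology_of F) (mtopology_of X)) ?O"
    unfolding mtopology_of_sum_metric[symmetric] by (rule bilip_at_preimage[OF UN fb(1) G])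
  have "b \<in> mspace X" using openin_mtopology_of_subset[OF N(1)] N(2) by blast
  then have cb: "compactin (mtopology_of X) {b}" by simp
  have KO: "K \<times> {b} \<subseteq> ?O"
  proof clarify
    fix x assume x: "x \<in> K"
    then have xx: "(x, b) \<in> U \<times> N" "(x, b) \<in> V \<times> N" using sub(2) N(2) by auto
    have "f (x, b) = g (x, b)" using fb(3)[OF xx(1)] gb(3)[OF xx(2)] by simp
    then show "(x, b) \<in> U \<times> N \<and> f (x, b) \<in> g ` (V \<times> N)" using xx by blast
  qed
  obtain K' N' where N': "openin (mtopology_of F) K'" "openin (mtopology_of X) N'"
    "K \<subseteq> K'" "{b} \<subseteq> N'" "K' \<times> N' \<subseteq> ?O"
    by (rule Wallace_theorem_prod_topology[OF K cb O KO])
  define M where "M = N' \<inter> N"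
  define ginv where "ginv = inv_into (V \<times> N) g"
  \<comment> \<open>\<open>restrict\<close> makes the maps extensional, so that they are points of
    the function space in \<open>Lstar\<close>.\<close>
  define \<phi> where "\<phi> t = restrict (\<lambda>x. fst (ginv (f (x, t)))) W" for t
  have ginv: "ginv (g z) = z" if "z \<in> V \<times> N" for z
    using that g(1) by (simp add: ginv_def)
  have key: "(x, t) \<in> U \<times> N" "(\<phi> t x, t) \<in> V \<times> N" "g (\<phi> t x, t) = f (x, t)"
    "ginv (f (x, t)) = (\<phi> t x, t)"
    if tx: "t \<in> M" "x \<in> W" for t x
  proof -
    have "(x, t) \<in> ?O" using tx N'(3,5) sub(1) by (auto simp: M_def)
    then obtain z where z: "(x, t) \<in> U \<times> N" "z \<in> V \<times> N" "f (x, t) = g z" by blast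
    \<comment> \<open>Both charts lie over \<open>X\<close>, so inverting \<open>g\<close> keeps the
      parameter and moves only the fiber coordinate.\<close>
    have "snd z = t" using fb(2)[OF z(1)] gb(2)[OF z(2)] z(3) by simp
    moreover have "\<phi> t x = fst z" using tx z ginv by (simp add: \<phi>_def)
    ultimately have eq: "z = (\<phi> t x, t)" by (simp add: prod_eq_iff)
    show "(x, t) \<in> U \<times> N" by (rule z(1))
    show "(\<phi> t x, t) \<in> V \<times> N" "g (\<phi> t x, t) = f (x, t)" "ginv (f (x, t)) = (\<phi> t x, t)"
      using z eq ginv by simp_all
  qed
  have M: "openin (mtopology_of X) M" "b \<in> M" "M \<subseteq> N"
    using N N' by (auto simp: M_def)
  have MW: "openin (mtopology_of Q) (M \<times> W)"
    unfolding Q_def by (rule openin_sum_metric_Times[OF M(1) W])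
  show thesis
  proof (rule that[OF M, of \<phi>])
    show "\<phi> t \<in> extensional W" for t by (simp add: \<phi>_def)
    show "bilip_at Q Q (\<lambda>(t, x). (t, \<phi> t x)) (t, x)" if tx: "t \<in> M" "x \<in> W" for t x
    proof -
      note k = key[OF tx]
      have m: "x \<in> mspace F" "t \<in> mspace X" "\<phi> t x \<in> mspace F"
        using k(1,2) openin_mtopology_of_subset[OF U] openin_mtopology_of_subset[OF V]
          openin_mtopology_of_subset[OF N(1)] by auto
      have 1: "bilip_at Q ?P prod.swap (t, x)"
        unfolding Q_def using m by (intro bilip_at_swap)
      have 2: "bilip_at ?P E f (prod.swap (t, x))" using fb(1)[OF k(1)] by simp
      have "bilip_at E ?P ginv (g (\<phi> t x, t))"
        using ginv by (rule bilip_at_inverse[OF gb(1)[OF k(2)] VN k(2)])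
      then have 3: "bilip_at E ?P ginv (f (prod.swap (t, x)))" using k(3) by simp
      have "bilip_at ?P Q prod.swap (\<phi> t x, t)"
        unfolding Q_def using m by (intro bilip_at_swap)
      then have 4: "bilip_at ?P Q prod.swap (ginv (f (prod.swap (t, x))))" using k(4) by simp
      have "bilip_at Q Q (\<lambda>v. prod.swap (ginv (f (prod.swap v)))) (t, x)"
        by (rule bilip_at_compose[OF bilip_at_compose[OF bilip_at_compose[OF 1 2] 3] 4])
      then show ?thesis
      proof (rule bilip_at_cong[OF _ MW])
        show "(t, x) \<in> M \<times> W" using tx by simp
        show "prod.swap (ginv (f (prod.swap v))) = (case v of (t, x) \<Rightarrow> (t, \<phi> t x))"
          if "v \<in> M \<times> W" for v
          using that key(4) by auto
      qed
    qed
    show "inj_on (\<phi> t) W" if t: "t \<in> M" for t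
    proof
      fix x y assume xy: "x \<in> W" "y \<in> W" "\<phi> t x = \<phi> t y"
      then have "f (x, t) = f (y, t)"
        using key(3)[OF t xy(1)] key(3)[OF t xy(2)] by simp
      then have "(x, t) = (y, t)"
        by (rule inj_onD[OF f(1) _ key(1)[OF t xy(1)] key(1)[OF t xy(2)]])
      then show "x = y" by simp
    qed
    show "\<phi> b = restrict (\<lambda>x. x) W"
    proof
      fix x
      show "\<phi> b x = restrict (\<lambda>x. x) W x"
      proof (cases "x \<in> W")
        case True
        note k = key[OF M(2) True]
        show ?thesis using fb(3)[OF k(1)] gb(3)[OF k(2)] k(3) True by simp
      next
        case False
        then show ?thesis by (simp add: \<phi>_def)
      qed
    qed
    show "g (\<phi> t x, t) = f (x, t)" if "t \<in> M" "x \<in> W" for t x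
      by (rule key(3)[OF that])
  qed
qed

text \<open>The change of coordinates (x, t) \<mapsto> (\<Phi>_t x, t) preserves the parameter and
  fixes the slice over \<open>b\<close>. Hence it preserves the projection and base conditions, and
  the preimage of the open set of germ points of \<open>g\<close> still contains
  \<open>(u, b)\<close>.\<close>

lemma product_germ_precompose:
  fixes E :: "'e metric" and X :: "'x metric" and p :: "'e \<Rightarrow> 'x" and b :: 'x
  defines "F \<equiv> fiber E p b"
  defines "Q \<equiv> sum_metric X F"
  assumes u: "u \<in> mspace F" and g: "product_germ E X p b g (u, b)"
    and M: "openin (mtopology_of X) M" "b \<in> M"
    and bl: "\<And>t x. t \<in> M \<Longrightarrow> x \<in> mspace F \<Longrightarrow> bilip_at Q Q (\<lambda>(t, x). (t, \<Phi> t x)) (t, x)"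
    and base: "\<And>x. x \<in> mspace F \<Longrightarrow> \<Phi> b x = x"
  shows "product_germ E X p b (\<lambda>(x, t). g (\<Phi> t x, t)) (u, b)"
proof -
  let ?P = "sum_metric F X"
  let ?J = "\<lambda>(x, t). (\<Phi> t x, t)"
  have FM: "openin (mtopology_of ?P) (mspace F \<times> M)"
    using openin_topspace[of "mtopology_of F"] M(1) by (intro openin_sum_metric_Times) auto
  have J: "bilip_at ?P ?P ?J z" if z: "z \<in> mspace F \<times> M" for z
  proof -
    obtain x t where xt: "z = (x, t)" "x \<in> mspace F" "t \<in> M" using z by auto
    have t: "t \<in> mspace X" using xt(3) openin_mtopology_of_subset[OF M(1)] by blast
    have 1: "bilip_at ?P Q prod.swap (x, t)"
      unfolding Q_def using xt t by (intro bilip_at_swap)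
    have 2: "bilip_at Q Q (\<lambda>(t, x). (t, \<Phi> t x)) (prod.swap (x, t))"
      using bl[OF xt(3,2)] by simp
    have "(t, \<Phi> t x) \<in> mspace Q" using bilip_at_in_mspace(2)[OF 2] by simp
    then have "bilip_at Q ?P prod.swap (t, \<Phi> t x)"
      unfolding Q_def by (intro bilip_at_swap) simp_all
    then have 3: "bilip_at Q ?P prod.swap ((\<lambda>(t, x). (t, \<Phi> t x)) (prod.swap (x, t)))" by simp
    have "bilip_at ?P ?P (\<lambda>v. prod.swap ((\<lambda>(t, x). (t, \<Phi> t x)) (prod.swap v))) z"
      unfolding xt(1) by (rule bilip_at_compose[OF bilip_at_compose[OF 1 2] 3])
    moreover have "(\<lambda>v. prod.swap ((\<lambda>(t, x). (t, \<Phi> t x)) (prod.swap v))) = ?J"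
      by (auto simp: fun_eq_iff)
    ultimately show ?thesis by simp
  qed
  let ?S = "{z \<in> mspace F \<times> M. ?J z \<in> {z. product_germ E X p b g z}}"
  show ?thesis
  proof (rule product_germI[of _ _ _ _ ?S])
    show "openin (mtopology_of (sum_metric (fiber E p b) X)) ?S"
      using bilip_at_preimage[OF FM J openin_Collect_product_germ[of E p b X g, folded F_def]]
      unfolding F_def .
    show "(u, b) \<in> ?S" using u M(2) g base by simp
    fix z assume z: "z \<in> ?S"
    then have zFM: "z \<in> mspace F \<times> M" and germ: "product_germ E X p b g (?J z)" by blast+
    have eq: "(\<lambda>(x, t). g (\<Phi> t x, t)) = (\<lambda>v. g (?J v))" by (auto simp: fun_eq_iff)
    show "bilip_at (sum_metric (fiber E p b) X) E (\<lambda>(x, t). g (\<Phi> t x, t)) z"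
      unfolding eq
      by (rule bilip_at_compose[OF J[OF zFM, unfolded F_def] product_germD(1)[OF germ]])
    show "p ((\<lambda>(x, t). g (\<Phi> t x, t)) z) = snd z"
      using product_germD(2)[OF germ] by (simp add: split_beta)
    show "(\<lambda>(x, t). g (\<Phi> t x, t)) z = fst z" if "snd z = b"
      using product_germD(3)[OF germ] that base zFM by (auto simp: split_beta)
  qed
qed

lemma product_germ_Un:
  fixes E :: "'e metric" and X :: "'x metric" and p :: "'e \<Rightarrow> 'x" and b :: 'x
  defines "F \<equiv> fiber E p b"
  assumes b: "b \<in> mspace X" and lc: "locally_compact_space (mtopology_of F)"
    and L: "Lstar TYPE('x) F"
    and A: "compactin (mtopology_of F) A" and f: "\<And>u. u \<in> A \<Longrightarrow> product_germ E X p b f (u, b)"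
    and B: "compactin (mtopology_of F) B" and g: "\<And>u. u \<in> B \<Longrightarrow> product_germ E X p b g (u, b)"
  obtains k where "\<And>u. u \<in> A \<union> B \<Longrightarrow> product_germ E X p b k (u, b)"
proof -
  let ?P = "sum_metric F X"
  note haus = Hausdorff_space_mtopology_of[of F]
  have mX: "openin (mtopology_of X) (mspace X)"
    using openin_topspace[of "mtopology_of X"] by simp
  obtain U N1 where U: "openin (mtopology_of F) U" "A \<subseteq> U"
    and N1: "openin (mtopology_of X) N1" "b \<in> N1"
    and f_inj: "inj_on f (U \<times> N1)" and f_germ: "\<And>z. z \<in> U \<times> N1 \<Longrightarrow> product_germ E X p b f z"
    using product_germ_compact[OF b A[unfolded F_def] f] unfolding F_def by metis
  obtain V N2 where V: "openin (mtopology_of F) V" "B \<subseteq> V"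
    and N2: "openin (mtopology_of X) N2" "b \<in> N2"
    and g_inj: "inj_on g (V \<times> N2)" and g_germ: "\<And>z. z \<in> V \<times> N2 \<Longrightarrow> product_germ E X p b g z"
    using product_germ_compact[OF b B[unfolded F_def] g] unfolding F_def by metis
  define N where "N = N1 \<inter> N2"
  have N: "openin (mtopology_of X) N" "b \<in> N"
    using N1 N2 by (auto simp: N_def)
  have fN: "inj_on f (U \<times> N)" "\<And>z. z \<in> U \<times> N \<Longrightarrow> product_germ E X p b f z"
    by (rule inj_on_subset[OF f_inj], force simp: N_def, rule f_germ, auto simp: N_def)
  have gN: "inj_on g (V \<times> N)" "\<And>z. z \<in> V \<times> N \<Longrightarrow> product_germ E X p b g z"
    by (rule inj_on_subset[OF g_inj], force simp: N_def, rule g_germ, auto simp: N_def)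
  have closedA: "closedin (mtopology_of F) A" by (rule compactin_imp_closedin[OF haus A])
  have AB: "compactin (mtopology_of F) (A \<inter> B)"
    by (rule closed_Int_compactin[OF closedA B])
  have ABUV: "A \<inter> B \<subseteq> U \<inter> V" using U(2) V(2) by blast
  \<comment> \<open>\<open>D\<close> is the compact set on which the extension will agree with the
    transition, and \<open>D'\<close> the open set around \<open>A \<inter> B\<close> on which the
    two maps can be pasted.\<close>
  obtain D' D where D': "openin (mtopology_of F) D'" and D: "compactin (mtopology_of F) D"
    and DD: "A \<inter> B \<subseteq> D'" "D' \<subseteq> D" "D \<subseteq> U \<inter> V"
    by (rule compact_between[OF lc haus AB openin_Int[OF U(1) V(1)] ABUV])
  \<comment> \<open>\<open>W\<close> is the open domain of the transition maps, and the compact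
    \<open>K\<close> makes them defined for all nearby parameters at once.\<close>
  obtain W K where W: "openin (mtopology_of F) W" and K: "compactin (mtopology_of F) K"
    and WK: "D \<subseteq> W" "W \<subseteq> K" "K \<subseteq> U \<inter> V"
    by (rule compact_between[OF lc haus D openin_Int[OF U(1) V(1)] DD(3)])
  obtain M \<phi> where M: "openin (mtopology_of X) M" "b \<in> M" "M \<subseteq> N"
    and \<phi>: "\<And>t. t \<in> M \<Longrightarrow> \<phi> t \<in> extensional W"
      "\<And>t x. t \<in> M \<Longrightarrow> x \<in> W \<Longrightarrow>
        bilip_at (sum_metric X F) (sum_metric X F) (\<lambda>(t, x). (t, \<phi> t x)) (t, x)"
      "\<And>t. t \<in> M \<Longrightarrow> inj_on (\<phi> t) W" "\<phi> b = restrict (\<lambda>x. x) W"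
    and trans: "\<And>t x. t \<in> M \<Longrightarrow> x \<in> W \<Longrightarrow> g (\<phi> t x, t) = f (x, t)"
    by (rule product_germ_transition[OF U(1)[unfolded F_def] V(1)[unfolded F_def] N fN gN
          W[unfolded F_def] K[unfolded F_def] WK(2,3), folded F_def]) (assumption | (rule that; assumption))+
  obtain M' \<Phi> where M': "openin (mtopology_of X) M'" "b \<in> M'" "M' \<subseteq> M"
    and \<Phi>: "\<And>t x. t \<in> M' \<Longrightarrow> x \<in> mspace F \<Longrightarrow>
        bilip_at (sum_metric X F) (sum_metric X F) (\<lambda>(t, x). (t, \<Phi> t x)) (t, x)"
      "\<And>t x. t \<in> M' \<Longrightarrow> x \<in> D \<Longrightarrow> \<Phi> t x = \<phi> t x"
      "\<And>x. x \<in> mspace F \<Longrightarrow> \<Phi> b x = x"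
    by (rule Lstar_extend_isotopy[OF L W D WK(1) M(1,2) \<phi>]) (assumption | (rule that; assumption))+
  let ?g' = "\<lambda>(x, t). g (\<Phi> t x, t)"
  have g': "product_germ E X p b ?g' (u, b)" if "u \<in> B" for u
  proof (rule product_germ_precompose[OF _ _ M'(1,2)])
    show "u \<in> mspace (fiber E p b)"
      using compactin_subset_topspace[OF B] that by (auto simp: F_def)
  qed (use that g \<Phi> in \<open>simp_all add: F_def\<close>)
  have D'closed: "closedin (mtopology_of F) (mspace F - D')"
    using closedin_diff[OF closedin_topspace D'] by simp
  \<comment> \<open>Once \<open>D'\<close> is removed, the rests of \<open>A\<close> and
    \<open>B\<close> are disjoint compact sets and have disjoint open neighborhoods, on which there
    is nothing to match.\<close>
  have "compactin (mtopology_of F) ((mspace F - D') \<inter> A)" "compactin (mtopology_of F) ((mspace F - D') \<inter> B)"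
    by (rule closed_Int_compactin[OF D'closed A], rule closed_Int_compactin[OF D'closed B])
  moreover have "disjnt ((mspace F - D') \<inter> A) ((mspace F - D') \<inter> B)"
    using DD(1) by (auto simp: disjnt_def)
  ultimately obtain OA OB where OA: "openin (mtopology_of F) OA" "(mspace F - D') \<inter> A \<subseteq> OA"
    and OB: "openin (mtopology_of F) OB" "(mspace F - D') \<inter> B \<subseteq> OB" and disj: "disjnt OA OB"
    by (rule Hausdorff_space_compact_separation[OF haus])
  \<comment> \<open>The set \<open>OA\<close> may cut through \<open>D'\<close>. This does no harm:
    near the central slice both formulas have the same value over \<open>D'\<close>, whichever
    branch is taken.\<close>
  define k where "k = (\<lambda>(x, t). if x \<in> OA then f (x, t) else g (\<Phi> t x, t))"
  have "product_germ E X p b k (u, b)" if u: "u \<in> A \<union> B" for u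
  proof -
    have uF: "u \<in> mspace F"
      using u compactin_subset_topspace[OF A] compactin_subset_topspace[OF B] by auto
    consider "u \<in> D'" | "u \<in> A" "u \<in> OA" | "u \<in> B" "u \<in> OB"
      using u uF OA(2) OB(2) by blast
    then show ?thesis
    proof cases
      case 1
      \<comment> \<open>Here \<open>u\<close> need not lie in \<open>A\<close>: \<open>f\<close> has
        been spread to all of \<open>U\<close>, which contains \<open>D'\<close>. Over
        \<open>D' \<times> M'\<close> the second branch equals g(\<phi>_t x, t) = f(x, t).\<close>
      have "product_germ E X p b f (u, b)" using 1 DD N(2) by (intro fN(2)) blast
      then show ?thesis
      proof (rule product_germ_cong)
        show "openin (mtopology_of (sum_metric (fiber E p b) X)) (D' \<times> M')"
          using openin_sum_metric_Times[OF D' M'(1)] by (simp add: F_def)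
        show "(u, b) \<in> D' \<times> M'" using 1 M'(2) by simp
        fix w assume "w \<in> D' \<times> M'"
        then obtain x t where w: "w = (x, t)" "x \<in> D'" "t \<in> M'" by blast
        then have "x \<in> D" "x \<in> W" "t \<in> M" using DD(2) WK(1) M'(3) by auto
        then show "f w = k w" using w trans \<Phi>(2) by (simp add: k_def)
      qed
    next
      case 2
      show ?thesis
      proof (rule product_germ_cong[OF f[OF 2(1)]])
        show "openin (mtopology_of (sum_metric (fiber E p b) X)) (OA \<times> mspace X)"
          using openin_sum_metric_Times[OF OA(1) mX] by (simp add: F_def)
        show "(u, b) \<in> OA \<times> mspace X" using 2 b by simp
        show "f w = k w" if "w \<in> OA \<times> mspace X" for w using that by (auto simp: k_def)
      qed
    next
      case 3
      show ?thesis
      proof (rule product_germ_cong[OF g'[OF 3(1)]])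
        show "openin (mtopology_of (sum_metric (fiber E p b) X)) (OB \<times> mspace X)"
          using openin_sum_metric_Times[OF OB(1) mX] by (simp add: F_def)
        show "(u, b) \<in> OB \<times> mspace X" using 3 b by simp
        show "?g' w = k w" if "w \<in> OB \<times> mspace X" for w
          using that disj by (auto simp: k_def disjnt_iff)
      qed
    qed
  qed
  then show thesis by (rule that)
qed

section \<open>Charts along compact subsets of a fiber\<close>

lemma lipschitz_submersion_germ:
  assumes sub: "lipschitz_submersion E X p" and u: "u \<in> mspace (fiber E p b)"
  obtains f where "product_germ E X p b f (u, b)"
proof -
  have "u \<in> mspace E" "p u = b" using u by auto
  with sub obtain U N f where f: "lipschitz_product_chart E X p b U N f" "u \<in> U"
    unfolding lipschitz_submersion_def by blast
  show thesis by (rule that[OF chart_imp_product_germ[OF f]])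
qed

text \<open>Gluing works for compact sets and not for open ones, so each local chart is first
  restricted to a compact neighborhood, which local compactness of the fiber provides. Compact sets
  carrying a single germ are closed under finite unions, and finitely many of them cover
  \<open>C\<close>.\<close>

lemma product_germ_along_compact:
  fixes E :: "'e metric" and X :: "'x metric" and p :: "'e \<Rightarrow> 'x" and b :: 'x
  defines "F \<equiv> fiber E p b"
  assumes sub: "lipschitz_submersion E X p" and b: "b \<in> mspace X"
    and lc: "locally_compact_space (mtopology_of F)" and L: "Lstar TYPE('x) F"
    and C: "compactin (mtopology_of F) C"
  obtains f where "\<And>u. u \<in> C \<Longrightarrow> product_germ E X p b f (u, b)"
proof -
  define good where "good K \<longleftrightarrow> compactin (mtopology_of F) K \<and>
      (\<exists>f. \<forall>u\<in>K. product_germ E X p b f (u, b))" for K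
  have good_Un: "good (K \<union> K')" if "good K" "good K'" for K K'
  proof -
    obtain f where K: "compactin (mtopology_of F) K" "\<And>u. u \<in> K \<Longrightarrow> product_germ E X p b f (u, b)"
      using \<open>good K\<close> unfolding good_def by blast
    obtain g where K': "compactin (mtopology_of F) K'" "\<And>u. u \<in> K' \<Longrightarrow> product_germ E X p b g (u, b)"
      using \<open>good K'\<close> unfolding good_def by blast
    obtain k where "\<And>u. u \<in> K \<union> K' \<Longrightarrow> product_germ E X p b k (u, b)"
      by (rule product_germ_Un[OF b lc[unfolded F_def] L[unfolded F_def] K[unfolded F_def] K'[unfolded F_def]])
        (assumption | (rule that; assumption))+
    moreover have "compactin (mtopology_of F) (K \<union> K')" by (rule compactin_Un[OF K(1) K'(1)])
    ultimately show ?thesis unfolding good_def by blast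
  qed
  have good_Union: "good (\<Union>\<K>)" if "finite \<K>" "\<forall>K\<in>\<K>. good K" for \<K>
    using that
  proof (induction rule: finite_induct)
    case empty
    show ?case by (simp add: good_def)
  next
    case (insert K \<K>)
    then show ?case using good_Un by simp
  qed
  have "\<exists>V. openin (mtopology_of F) V \<and> u \<in> V \<and> (\<exists>K. V \<subseteq> K \<and> good K)" if u: "u \<in> C" for u
  proof -
    have uF: "u \<in> mspace F" using compactin_subset_topspace[OF C] u by auto
    then obtain f where f: "product_germ E X p b f (u, b)"
      using lipschitz_submersion_germ[OF sub, of u b] unfolding F_def by blast
    \<comment> \<open>The germ points of one local chart on the central slice; this set is open
      since the inclusion of the slice is continuous.\<close>
    let ?T = "{v \<in> mspace F. product_germ E X p b f (v, b)}"
    have T: "openin (mtopology_of F) ?T"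
    proof -
      have "continuous_map (mtopology_of F) (mtopology_of (sum_metric F X)) (\<lambda>v. (v, b))"
        unfolding mtopology_of_sum_metric using b by (intro continuous_map_pairedI) auto
      from openin_continuous_map_preimage[OF this openin_Collect_product_germ[of E p b X f, folded F_def]]
      show ?thesis by simp
    qed
    have "compactin (mtopology_of F) {u}" using uF by simp
    then obtain V K where VK: "openin (mtopology_of F) V" "compactin (mtopology_of F) K"
      "{u} \<subseteq> V" "V \<subseteq> K" "K \<subseteq> ?T"
      by (rule compact_between[OF lc Hausdorff_space_mtopology_of _ T]) (use uF f in auto)
    have "good K" using VK(2,5) unfolding good_def by (intro conjI exI[of _ f]) auto
    then show ?thesis using VK by (intro exI[of _ V]) auto
  qed
  then obtain V where V: "\<And>u. u \<in> C \<Longrightarrow> openin (mtopology_of F) (V u) \<and> u \<in> V u \<and> (\<exists>K. V u \<subseteq> K \<and> good K)"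
    by metis
  then have "\<forall>u\<in>C. \<exists>K. V u \<subseteq> K \<and> good K" by simp
  then obtain K where K: "\<And>u. u \<in> C \<Longrightarrow> V u \<subseteq> K u \<and> good (K u)"
    by metis
  have "C \<subseteq> \<Union>(V ` C)" using V by blast
  then obtain \<F> where \<F>: "finite \<F>" "\<F> \<subseteq> V ` C" "C \<subseteq> \<Union>\<F>"
    using C[unfolded compactin_def, THEN conjunct2, rule_format, of "V ` C"] V by auto
  then obtain C' where C': "C' \<subseteq> C" "finite C'" "\<F> = V ` C'"
    using finite_subset_image[OF \<F>(1,2)] by auto
  have goodK: "good (\<Union>(K ` C'))" using C' K by (intro good_Union) auto
  have CK: "C \<subseteq> \<Union>(K ` C')" using \<F>(3) C' K by blast
  from goodK obtain f where f: "\<forall>u\<in>\<Union>(K ` C'). product_germ E X p b f (u, b)"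
    unfolding good_def by (elim conjE exE)
  show thesis by (rule that[of f], rule bspec[OF f], rule subsetD[OF CK])
qed

lemma product_chart_along_compact:
  fixes E :: "'e metric" and X :: "'x metric" and p :: "'e \<Rightarrow> 'x" and b :: 'x
  defines "F \<equiv> fiber E p b"
  assumes sub: "lipschitz_submersion E X p" and b: "b \<in> mspace X"
    and lc: "locally_compact_space (mtopology_of F)" and L: "Lstar TYPE('x) F"
    and C: "compactin (mtopology_of F) C"
  obtains U N f where "openin (mtopology_of F) U" "openin (mtopology_of X) N" "C \<subseteq> U" "b \<in> N"
    "inj_on f (U \<times> N)" "\<And>z. z \<in> U \<times> N \<Longrightarrow> product_germ E X p b f z"
proof -
  obtain f where f: "\<And>u. u \<in> C \<Longrightarrow> product_germ E X p b f (u, b)"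
    by (rule product_germ_along_compact[OF sub b lc[unfolded F_def] L[unfolded F_def] C[unfolded F_def]]) blast
  show thesis
    by (rule product_germ_compact[OF b C[unfolded F_def] f])
      (assumption | (rule that[unfolded F_def]; assumption))+
qed

section \<open>Trivialization of proper submersions\<close>

lemma lipschitz_map_funcset:
  assumes "lipschitz_map X Y f" shows "f \<in> mspace X \<rightarrow> mspace Y"
proof
  fix x assume "x \<in> mspace X"
  then obtain V where "x \<in> V" "Lipschitz_continuous_map (submetric X V) Y f"
    using assms unfolding lipschitz_map_def by blast
  then show "f x \<in> mspace Y"
    using \<open>x \<in> mspace X\<close> by (auto simp: Lipschitz_continuous_map_def)
qed

text \<open>Properness is used twice: fibers are compact, so one chart exists about a whole fiber,
  and \<open>p\<close> is closed, so the points over which the image of that chart misses part of a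
  fiber stay away from \<open>b\<close>. An empty fiber is covered as well; the image is then empty
  and the fibers over \<open>N'\<close> are empty too.\<close>

lemma proper_submersion_trivialization:
  fixes E :: "'e metric" and X :: "'x metric" and p :: "'e \<Rightarrow> 'x" and b :: 'x
  assumes sub: "lipschitz_submersion E X p" and b: "b \<in> mspace X"
    and proper: "proper_map (mtopology_of E) (mtopology_of X) p"
    and L: "Lstar TYPE('x) (fiber E p b)"
  shows "\<exists>N h. N \<subseteq> mspace X \<and> b \<in> mtopology_of X interior_of N \<and>
        lipschitz_isomorphism (sum_metric (fiber E p b) (submetric X N))
          (submetric E {e \<in> mspace E. p e \<in> N}) h \<and>
        (\<forall>e\<in>mspace (fiber E p b). \<forall>n\<in>N. p (h (e, n)) = n)"
proof -
  let ?F = "fiber E p b" and ?P = "sum_metric (fiber E p b) X"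
  have "compactin (mtopology_of E) {e \<in> mspace E. p e = b}"
    using proper b by (simp add: proper_map_def)
  then have comp: "compact_space (mtopology_of ?F)"
    by (simp add: fiber_def mtopology_of_submetric compactin_subspace)
  then have C: "compactin (mtopology_of ?F) (mspace ?F)"
    by (simp add: compact_space_def del: mspace_fiber)
  have lc: "locally_compact_space (mtopology_of ?F)"
    by (rule compact_imp_locally_compact_space[OF comp])
  obtain U N f where U: "openin (mtopology_of ?F) U" "mspace ?F \<subseteq> U"
    and N: "openin (mtopology_of X) N" "b \<in> N"
    and f: "inj_on f (U \<times> N)" "\<And>z. z \<in> U \<times> N \<Longrightarrow> product_germ E X p b f z"
    by (rule product_chart_along_compact[OF sub b lc L C]) (assumption | (rule that; assumption))+
  have UF: "U = mspace ?F" using U openin_mtopology_of_subset by blast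
  define G where "G = f ` (U \<times> N)"
  have UN: "openin (mtopology_of ?P) (U \<times> N)" by (rule openin_sum_metric_Times[OF U(1) N(1)])
  have G: "openin (mtopology_of E) G"
    unfolding G_def by (rule bilip_at_image[OF UN product_germD(1)[OF f(2)]])
  have "closedin (mtopology_of E) (mspace E - G)"
    using closedin_diff[OF closedin_topspace G] by simp
  then have closed: "closedin (mtopology_of X) (p ` (mspace E - G))"
    using proper by (simp add: proper_map_def closed_map_def)
  \<comment> \<open>The set removed consists of the base points whose fiber is not contained in
    \<open>G\<close>. It is closed, being the image of a closed set under a closed map.\<close>
  define N' where "N' = N \<inter> (mspace X - p ` (mspace E - G))"
  have N': "openin (mtopology_of X) N'"
    unfolding N'_def using openin_diff[OF openin_topspace closed] N(1) by (intro openin_Int) simp_all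
  \<comment> \<open>Over \<open>b\<close> the chart is the identity on the whole fiber, so this
    fiber lies in \<open>G\<close>.\<close>
  have "b \<notin> p ` (mspace E - G)"
  proof
    assume "b \<in> p ` (mspace E - G)"
    then obtain e where e: "e \<in> mspace E" "e \<notin> G" "p e = b" by auto
    then have eU: "(e, b) \<in> U \<times> N" using UF N(2) by simp
    then have "f (e, b) = e" using product_germD(3)[OF f(2)] by fastforce
    then show False using e(2) eU unfolding G_def by force
  qed
  then have bN': "b \<in> N'" using b N(2) by (simp add: N'_def)
  define S where "S = {e \<in> mspace E. p e \<in> N'}"
  have UN': "openin (mtopology_of ?P) (U \<times> N')" by (rule openin_sum_metric_Times[OF U(1) N'])
  have sub': "U \<times> N' \<subseteq> U \<times> N" by (auto simp: N'_def)
  have img: "f ` (U \<times> N') = S"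
  proof (intro equalityI subsetI)
    fix e assume "e \<in> f ` (U \<times> N')"
    then obtain z where z: "z \<in> U \<times> N'" "e = f z" by blast
    then have germ: "product_germ E X p b f z" using sub' f(2) by blast
    then show "e \<in> S"
      using product_germD(2)[OF germ] bilip_at_in_mspace(2)[OF product_germD(1)[OF germ]] z
      by (auto simp: S_def)
  next
    fix e assume e: "e \<in> S"
    then have "e \<in> G" by (auto simp: S_def N'_def)
    then obtain z where z: "z \<in> U \<times> N" "e = f z" unfolding G_def by blast
    then have "p e = snd z" using product_germD(2)[OF f(2)] by blast
    then have "z \<in> U \<times> N'" using z(1) e by (auto simp: S_def)
    then show "e \<in> f ` (U \<times> N')" using z(2) by blast
  qed
  have dom: "sum_metric ?F (submetric X N') = submetric ?P (U \<times> N')"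
    using sum_metric_submetric[of ?F "mspace ?F" X N'] by (simp add: UF del: mspace_fiber)
  have inj: "inj_on f (U \<times> N')" by (rule inj_on_subset[OF f(1) sub'])
  have "bilip_at ?P (submetric E S) f z" if z: "z \<in> U \<times> N'" for z
  proof (rule bilip_at_submetric_cod[OF _ UN' z])
    show "bilip_at ?P E f z" by (rule product_germD(1)[OF f(2)[OF subsetD[OF sub' z]]])
    show "f ` (U \<times> N') \<subseteq> S" using img by simp
  qed
  then have "open_lipschitz_embedding (submetric ?P (U \<times> N')) (submetric E S) f"
    unfolding open_lipschitz_embedding_submetric_iff[OF UN'] using inj by blast
  then have emb: "lipschitz_embedding (sum_metric ?F (submetric X N')) (submetric E S) f"
    by (simp add: dom open_lipschitz_embedding_def)
  have N'X: "N' \<subseteq> mspace X" by (rule openin_mtopology_of_subset[OF N'])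
  have "mspace (sum_metric ?F (submetric X N')) = U \<times> N'" using N'X UF by auto
  moreover have "mspace (submetric E S) = S" by (auto simp: S_def)
  ultimately have "bij_betw f (mspace (sum_metric ?F (submetric X N'))) (mspace (submetric E S))"
    using inj img by (simp add: bij_betw_def)
  then have "lipschitz_isomorphism (sum_metric ?F (submetric X N')) (submetric E S) f"
    using emb by (simp add: lipschitz_isomorphism_def)
  moreover have "p (f (e, n)) = n" if "e \<in> mspace ?F" "n \<in> N'" for e n
    using product_germD(2)[OF f(2), of "(e, n)"] that UF by (simp add: N'_def)
  moreover have "b \<in> mtopology_of X interior_of N'"
    using N' bN' by (simp add: interior_of_openin)
  ultimately show ?thesis using N'X unfolding S_def by blast
qed

theorem theorem2:
  fixes E :: "'e metric" and X :: "'x metric" and p :: "'e \<Rightarrow> 'x"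
  assumes "lipschitz_submersion E X p"
    and "locally_compact_space (mtopology_of X)"
    and "locally_connected_space (mtopology_of X)"
  shows "(\<forall>y\<in>mspace E.
            locally_connected_space (mtopology_of (fiber E p (p y))) \<and>
            locally_compact_space (mtopology_of (fiber E p (p y))) \<and>
            Lstar TYPE('x) (fiber E p (p y)) \<longrightarrow>
            (\<forall>C. compactin (mtopology_of (fiber E p (p y))) C \<longrightarrow>
               (\<exists>U N f. C \<subseteq> U \<and> lipschitz_product_chart E X p (p y) U N f))) \<and>
         (proper_map (mtopology_of E) (mtopology_of X) p \<and>
          (\<forall>x\<in>mspace X.
             locally_connected_space (mtopology_of (fiber E p x)) \<and>
             Lstar TYPE('x) (fiber E p x)) \<longrightarrow>
          lipschitz_bundle_map E X p)"
proof (intro conjI ballI impI allI)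
  have pX: "p \<in> mspace E \<rightarrow> mspace X"
    using assms(1) lipschitz_map_funcset by (auto simp: lipschitz_submersion_def)
  {
    fix y C
    assume y: "y \<in> mspace E"
      and F: "locally_connected_space (mtopology_of (fiber E p (p y))) \<and>
            locally_compact_space (mtopology_of (fiber E p (p y))) \<and>
            Lstar TYPE('x) (fiber E p (p y))"
      and C: "compactin (mtopology_of (fiber E p (p y))) C"
    have b: "p y \<in> mspace X" using pX y by blast
    from F have lc: "locally_compact_space (mtopology_of (fiber E p (p y)))"
      and L: "Lstar TYPE('x) (fiber E p (p y))" by blast+
    obtain U N f where "openin (mtopology_of (fiber E p (p y))) U" "openin (mtopology_of X) N"
      "C \<subseteq> U" "p y \<in> N" "inj_on f (U \<times> N)" "\<And>z. z \<in> U \<times> N \<Longrightarrow> product_germ E X p (p y) f z"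
      by (rule product_chart_along_compact[OF assms(1) b lc L C]) (assumption | (rule that; assumption))+
    then show "\<exists>U N f. C \<subseteq> U \<and> lipschitz_product_chart E X p (p y) U N f"
      using product_chartI by metis
  next
    assume proper: "proper_map (mtopology_of E) (mtopology_of X) p \<and>
          (\<forall>x\<in>mspace X.
             locally_connected_space (mtopology_of (fiber E p x)) \<and>
             Lstar TYPE('x) (fiber E p x))"
    then show "lipschitz_bundle_map E X p"
      unfolding lipschitz_bundle_map_def
      using pX proper_submersion_trivialization[OF assms(1)] by blast
  }
qed

end
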